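(* Assume that for all $0<\alpha\le 1$ and all infinite paths $(x_n)_{n\ge 1}$ in $X$ we have $$\sum_{n=1}^\infty \frac{m(x_n)\,\varphi(\alpha W(x_n))}{\deg(x_n)}=\infty.$$ Then $b$ over $(X,m)$ with $W$ and $\varphi$ is stochastically complete at infinity. In particular, this holds if the function $\deg/m$ is bounded.
   Context: Let $X \neq \emptyset$ be a countable set, $C(X)$ the real-valued functions on $X$, $C_c(X)$ those of finite support. Let $m\colon X \to (0,\infty)$. Let $b$ be a weighted graph over $X$: a symmetric function $b\colon X\times X \to [0,\infty)$ with $b(x,x)=0$ and $\deg(x) := \sum_{y\in X} b(x,y) < \infty$ for all $x \in X$. Write $x\sim y$ if $b(x,y)>0$. An infinite path is a sequence $(x_1,x_2,\ldots)$ in $X$ with $x_j\sim x_{j+1}$ for all $j\geq 1$ (repetitions allowed). Energy: $\mathcal Q(f) = \frac12\sum_{x,y\in X} b(x,y)(f(x)-f(y))^2 \in [0,\infty]$ for $f\in C(X)$, $\mathcal D = \{f : \mathcal Q(f)<\infty\}$, and $\mathcal D_0$ is the set of $f \in \mathcal D$ for which there is a sequence $(f_n)$ in $C_c(X)$ with $f_n \to f$ pointwise and $\mathcal Q(f-f_n)\to 0$. Standing assumptions: $\varphi\colon\mathbb R\to\mathbb R$ is continuous and strictly increasing with $\varphi(0)=0$; $W\colon X\to(0,\infty)$ with $\inf_{x\in X} W(x) > 0$. Dirichlet resolvent: let $\Phi(s)=\int_0^s 2\varphi(t)\,dt$. For $f\in C_c(X)$ let $\kappa_f(u)=\sum_{x\in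 X}\Phi(f(x)-W(x)u(x))\frac{m(x)}{W(x)} \in [0,\infty]$, $D(\mathcal E_f)=\{u\in\mathcal D_0 : \kappa_f(u)<\infty\}$ and $\mathcal E_f(u)=\mathcal Q(u)+\kappa_f(u)$ for $u\in D(\mathcal E_f)$. The functional $\mathcal E_f$ has a unique minimizer on $D(\mathcal E_f)$, denoted $R^{\varphi,W}f$. For $0\le f\in C(X)$ the extended Dirichlet resolvent $R^{\varphi,W}f\colon X\to[0,\infty]$ is $R^{\varphi,W}f(x)=\sup\{R^{\varphi,W}g(x) : g\in C_c(X),\ 0\le g\le f\}$ (for $f \in C_c(X)$ the two definitions agree). Stochastic completeness at infinity (non-linear version): $b$ over $(X,m)$ with $W$ and $\varphi$ is stochastically complete at infinity if $R^{\varphi,W}(\alpha W)=\alpha$ (constant function) for all $\alpha>0$. *)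

theory Defs
  imports "HOL-Analysis.Analysis"
begin

text \<open>The countable vertex set is rendered as a type of class \<open>countable\<close> (types are nonempty).\<close>

definition vertex_degree :: "('a \<Rightarrow> 'a \<Rightarrow> real) \<Rightarrow> 'a \<Rightarrow> real" where
  "vertex_degree b x = (\<Sum>\<^sub>\<infinity>y. b x y)"

definition weighted_graph :: "('a \<Rightarrow> 'a \<Rightarrow> real) \<Rightarrow> bool" where
  "weighted_graph b \<longleftrightarrow>
     (\<forall>x y. 0 \<le> b x y) \<and> (\<forall>x y. b x y = b y x) \<and> (\<forall>x. b x x = 0) \<and>
     (\<forall>x. (\<lambda>y. b x y) summable_on UNIV)"

definition adjacent :: "('a \<Rightarrow> 'a \<Rightarrow> real) \<Rightarrow> 'a \<Rightarrow> 'a \<Rightarrow> bool" where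
  "adjacent b x y \<longleftrightarrow> b x y > 0"

text \<open>Sequences start at index 0 instead of 1.\<close>

definition infinite_path :: "('a \<Rightarrow> 'a \<Rightarrow> real) \<Rightarrow> (nat \<Rightarrow> 'a) \<Rightarrow> bool" where
  "infinite_path b p \<longleftrightarrow> (\<forall>j. adjacent b (p j) (p (Suc j)))"

definition Cc :: "('a \<Rightarrow> real) set" where
  "Cc = {f. finite {x. f x \<noteq> 0}}"

definition energy :: "('a \<Rightarrow> 'a \<Rightarrow> real) \<Rightarrow> ('a \<Rightarrow> real) \<Rightarrow> ennreal" where
  "energy b f = (\<Sum>\<^sub>\<infinity>(x, y)\<in>UNIV. ennreal (b x y * (f x - f y)\<^sup>2)) / 2"

definition finite_energy :: "('a \<Rightarrow> 'a \<Rightarrow> real) \<Rightarrow> ('a \<Rightarrow> real) set" where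
  "finite_energy b = {f. energy b f < \<infinity>}"

definition finite_energy0 :: "('a \<Rightarrow> 'a \<Rightarrow> real) \<Rightarrow> ('a \<Rightarrow> real) set" where
  "finite_energy0 b = {f \<in> finite_energy b. \<exists>F :: nat \<Rightarrow> 'a \<Rightarrow> real.
     (\<forall>n. F n \<in> Cc) \<and> (\<forall>x. (\<lambda>n. F n x) \<longlonglongrightarrow> f x) \<and>
     (\<lambda>n. energy b (\<lambda>x. f x - F n x)) \<longlonglongrightarrow> 0}"

text \<open>The interval integral is oriented, so the primitive is nonnegative also for negative
  arguments when \<open>\<phi>\<close> is increasing with \<open>\<phi> 0 = 0\<close>. Hence no truncation occurs in the
  coercion to \<open>ennreal\<close> below.\<close>

definition primitive2 :: "(real \<Rightarrow> real) \<Rightarrow> real \<Rightarrow> real" where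
  "primitive2 \<phi> s = (LBINT t=0..s. 2 * \<phi> t)"

definition kappa ::
  "('a \<Rightarrow> real) \<Rightarrow> (real \<Rightarrow> real) \<Rightarrow> ('a \<Rightarrow> real) \<Rightarrow> ('a \<Rightarrow> real) \<Rightarrow> ('a \<Rightarrow> real) \<Rightarrow> ennreal" where
  "kappa m \<phi> W f u = (\<Sum>\<^sub>\<infinity>x. ennreal (primitive2 \<phi> (f x - W x * u x) * (m x / W x)))"

definition functional_domain ::
  "('a \<Rightarrow> 'a \<Rightarrow> real) \<Rightarrow> ('a \<Rightarrow> real) \<Rightarrow> (real \<Rightarrow> real) \<Rightarrow> ('a \<Rightarrow> real) \<Rightarrow> ('a \<Rightarrow> real) \<Rightarrow> ('a \<Rightarrow> real) set" where
  "functional_domain b m \<phi> W f = {u \<in> finite_energy0 b. kappa m \<phi> W f u < \<infinity>}"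

definition functional ::
  "('a \<Rightarrow> 'a \<Rightarrow> real) \<Rightarrow> ('a \<Rightarrow> real) \<Rightarrow> (real \<Rightarrow> real) \<Rightarrow> ('a \<Rightarrow> real) \<Rightarrow> ('a \<Rightarrow> real) \<Rightarrow> ('a \<Rightarrow> real) \<Rightarrow> ennreal" where
  "functional b m \<phi> W f u = energy b u + kappa m \<phi> W f u"

text \<open>Dirichlet resolvent, meaningful for \<open>f \<in> Cc\<close>.\<close>

definition dirichlet_resolvent ::
  "('a \<Rightarrow> 'a \<Rightarrow> real) \<Rightarrow> ('a \<Rightarrow> real) \<Rightarrow> (real \<Rightarrow> real) \<Rightarrow> ('a \<Rightarrow> real) \<Rightarrow> ('a \<Rightarrow> real) \<Rightarrow> 'a \<Rightarrow> real" where
  "dirichlet_resolvent b m \<phi> W f =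
     (THE u. u \<in> functional_domain b m \<phi> W f \<and>
        (\<forall>v \<in> functional_domain b m \<phi> W f. functional b m \<phi> W f u \<le> functional b m \<phi> W f v))"

text \<open>Extended Dirichlet resolvent, meaningful for \<open>f \<ge> 0\<close>.\<close>

definition extended_resolvent ::
  "('a \<Rightarrow> 'a \<Rightarrow> real) \<Rightarrow> ('a \<Rightarrow> real) \<Rightarrow> (real \<Rightarrow> real) \<Rightarrow> ('a \<Rightarrow> real) \<Rightarrow> ('a \<Rightarrow> real) \<Rightarrow> 'a \<Rightarrow> ereal" where
  "extended_resolvent b m \<phi> W f x =
     (SUP g \<in> {g \<in> Cc. \<forall>y. 0 \<le> g y \<and> g y \<le> f y}. ereal (dirichlet_resolvent b m \<phi> W g x))"

definition stochastically_complete_at_infinity ::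
  "('a \<Rightarrow> 'a \<Rightarrow> real) \<Rightarrow> ('a \<Rightarrow> real) \<Rightarrow> (real \<Rightarrow> real) \<Rightarrow> ('a \<Rightarrow> real) \<Rightarrow> bool" where
  "stochastically_complete_at_infinity b m \<phi> W \<longleftrightarrow>
     (\<forall>\<alpha>>0. extended_resolvent b m \<phi> W (\<lambda>x. \<alpha> * W x) = (\<lambda>_. ereal \<alpha>))"

end

theory Submission
  imports Defs "HOL-Complex_Analysis.Great_Picard"
begin

text \<open>Truncated at \<open>0\<close> and \<open>\<alpha>\<close>, a minimizing sequence for \<open>f \<le> \<alpha> W\<close> has a pointwise convergent
  subsequence, and the parallelogram identity makes it Cauchy in energy; so the minimizer \<open>u\<close>
  exists and satisfies \<open>0 \<le> u \<le> \<alpha>\<close>. Its Euler-Lagrange equation is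
  \<open>(\<Sum>y. b x y * (u x - u y)) = m x * \<phi> (f x - W x * u x)\<close>. Letting \<open>f\<close> run through truncations of \<open>\<alpha> W\<close>
  and extracting once more a convergent subsequence gives a limit \<open>u\<close> below the extended resolvent
  for which \<open>w = \<alpha> - u\<close> solves
  \<open>(\<Sum>y. b x y * (w y - w x)) = m x * \<phi> (W x * w x)\<close>. If \<open>w x > 0\<close>, some neighbour \<open>y\<close> has
  \<open>w y - w x \<ge> m x * \<phi> (W x * w x) / deg x\<close>; iterating gives an infinite path along which the divergent
  series is bounded by the oscillation of \<open>w \<in> [0, \<alpha>]\<close>. Hence \<open>w = 0\<close>.\<close>

section \<open>Unordered sums in \<open>ennreal\<close> as integrals over counting measure\<close>

lemma finite_to_nat_less: "finite {x::'a::countable. to_nat x < n}"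
  using finite_vimageI[of "{..<n}" "to_nat :: 'a \<Rightarrow> nat"] by (simp add: vimage_def)

text \<open>Both sides are suprema of finite partial sums: a countable type is exhausted by the
  increasing finite sets \<open>F n\<close>, so monotone convergence applies. This opens the sums
  defining \<open>energy\<close> and \<open>kappa\<close> to Fatou's lemma and dominated
  convergence.\<close>

lemma infsum_ennreal_eq_nn_integral:
  fixes f :: "'a::countable \<Rightarrow> ennreal"
  shows "(\<Sum>\<^sub>\<infinity>x. f x) = (\<integral>\<^sup>+x. f x \<partial>count_space UNIV)"
proof (rule antisym)
  have sum_eq: "sum f F = (\<integral>\<^sup>+x. f x * indicator F x \<partial>count_space UNIV)" if "finite F" for F
    using nn_integral_count_space_indicator[of F f] nn_integral_count_space_finite[OF that, of f]
    by (cases "F = UNIV") auto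
  show "(\<Sum>\<^sub>\<infinity>x. f x) \<le> (\<integral>\<^sup>+x. f x \<partial>count_space UNIV)"
    by (subst nonneg_infsum_complete)
       (auto intro!: SUP_least nn_integral_mono simp: sum_eq split: split_indicator)
  define F where "F n = {x::'a. to_nat x < n}" for n
  have fin: "finite (F n)" for n
    unfolding F_def by (rule finite_to_nat_less)
  have "(\<integral>\<^sup>+x. f x \<partial>count_space UNIV) = (\<integral>\<^sup>+x. (SUP n. f x * indicator (F n) x) \<partial>count_space UNIV)"
  proof (intro nn_integral_cong antisym)
    fix x :: 'a
    have "f x = f x * indicator (F (Suc (to_nat x))) x" by (simp add: F_def)
    also have "\<dots> \<le> (SUP n. f x * indicator (F n) x)" by (rule SUP_upper) simp
    finally show "f x \<le> (SUP n. f x * indicator (F n) x)" .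
    show "(SUP n. f x * indicator (F n) x) \<le> f x"
      by (auto intro!: SUP_least split: split_indicator)
  qed
  also have "\<dots> = (SUP n. (\<integral>\<^sup>+x. f x * indicator (F n) x \<partial>count_space UNIV))"
    by (intro nn_integral_monotone_convergence_SUP)
       (auto simp: incseq_def le_fun_def F_def split: split_indicator)
  also have "\<dots> \<le> (\<Sum>\<^sub>\<infinity>x. f x)"
    by (subst nonneg_infsum_complete) (auto intro!: SUP_least SUP_upper simp: sum_eq[OF fin, symmetric] fin)
  finally show "(\<integral>\<^sup>+x. f x \<partial>count_space UNIV) \<le> (\<Sum>\<^sub>\<infinity>x. f x)" .
qed

lemma ennreal_add_le_imp_le:
  fixes a b c :: ennreal
  assumes "a + b \<le> a + c" "a < \<infinity>"
  shows "b \<le> c"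
  using assms by (auto simp: ennreal_add_left_cancel_le)

lemma ennreal_four_half: "4 * (c / 2) = 2 * (c::ennreal)"
proof (cases c)
  case (real r)
  then have "c / 2 = ennreal (r / 2)" using divide_ennreal[of r 2] by simp
  then show ?thesis using real by (simp add: ennreal_mult[symmetric] flip: ennreal_numeral)
qed (simp add: ennreal_mult_top divide_ennreal_def)

section \<open>Energy on a weighted graph\<close>

locale graph =
  fixes b :: "'a::countable \<Rightarrow> 'a \<Rightarrow> real"
  assumes graph: "weighted_graph b"
begin

lemma b_nonneg [simp]: "0 \<le> b x y"
  and b_sym: "b x y = b y x"
  and b_diag [simp]: "b x x = 0"
  and b_summable: "(\<lambda>y. b x y) summable_on UNIV"
  using graph by (auto simp: weighted_graph_def)

text \<open>The factor 1/2 is absorbed into the summand, so that \<open>energy b f\<close> is a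
  plain integral over ordered pairs.\<close>

definition edge_energy :: "('a \<Rightarrow> real) \<Rightarrow> 'a \<times> 'a \<Rightarrow> real" where
  "edge_energy f p = b (fst p) (snd p) * (f (fst p) - f (snd p))\<^sup>2 / 2"

lemma edge_energy_nonneg [simp]: "0 \<le> edge_energy f p"
  by (simp add: edge_energy_def)

lemma energy_eq_nn_integral:
  "energy b f = (\<integral>\<^sup>+p. ennreal (edge_energy f p) \<partial>count_space UNIV)"
proof -
  have "energy b f = (\<integral>\<^sup>+p. ennreal (b (fst p) (snd p) * (f (fst p) - f (snd p))\<^sup>2) \<partial>count_space UNIV) / 2"
    by (simp add: energy_def infsum_ennreal_eq_nn_integral case_prod_unfold)
  also have "\<dots> = (\<integral>\<^sup>+p. ennreal (edge_energy f p) \<partial>count_space UNIV)"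
    by (subst nn_integral_divide[symmetric])
       (auto simp: edge_energy_def divide_ennreal[symmetric] intro!: nn_integral_cong)
  finally show ?thesis .
qed

lemma tendsto_edge_energy:
  assumes "\<And>x. (\<lambda>n. F n x) \<longlonglongrightarrow> f x"
  shows "(\<lambda>n. edge_energy (F n) p) \<longlonglongrightarrow> edge_energy f p"
  unfolding edge_energy_def by (intro tendsto_intros assms) simp

text \<open>Lower semicontinuity under pointwise convergence, by Fatou's lemma on the set of ordered
  pairs.\<close>

lemma energy_le_liminf:
  assumes "\<And>x. (\<lambda>n. F n x) \<longlonglongrightarrow> f x"
  shows "energy b f \<le> liminf (\<lambda>n. energy b (F n))"
proof -
  have "liminf (\<lambda>n. ennreal (edge_energy (F n) p)) = ennreal (edge_energy f p)" for p
    by (intro lim_imp_Liminf) (auto intro!: tendsto_ennrealI tendsto_edge_energy assms)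
  then show ?thesis
    using nn_integral_liminf[of "\<lambda>n p. ennreal (edge_energy (F n) p)" "count_space UNIV"]
    by (simp add: energy_eq_nn_integral)
qed

lemma edge_energy_scale: "edge_energy (\<lambda>x. c * f x) p = c\<^sup>2 * edge_energy f p"
  by (simp add: edge_energy_def power2_eq_square algebra_simps)

lemma energy_scale: "energy b (\<lambda>x. c * f x) = ennreal (c\<^sup>2) * energy b f"
  by (simp add: energy_eq_nn_integral edge_energy_scale ennreal_mult nn_integral_cmult)

text \<open>The identity holds edge by edge. The halves put it in the form in which midpoints of
  competitors occur below.\<close>

lemma energy_parallelogram:
  "energy b (\<lambda>x. (f x + g x) / 2) + energy b (\<lambda>x. (f x - g x) / 2) = (energy b f + energy b g) / 2"
proof -
  have "edge_energy (\<lambda>x. (f x + g x) / 2) p + edge_energy (\<lambda>x. (f x - g x) / 2) p =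
    (edge_energy f p + edge_energy g p) / 2" for p
    by (simp add: edge_energy_def field_simps power2_eq_square)
  then have "ennreal (edge_energy (\<lambda>x. (f x + g x) / 2) p) + ennreal (edge_energy (\<lambda>x. (f x - g x) / 2) p) =
    (ennreal (edge_energy f p) + ennreal (edge_energy g p)) / 2" for p
    by (metis (no_types, lifting) add_nonneg_nonneg divide_ennreal edge_energy_nonneg ennreal_numeral
        ennreal_plus zero_le_numeral zero_less_numeral)
  then show ?thesis
    unfolding energy_eq_nn_integral
    by (simp add: nn_integral_add[symmetric] nn_integral_divide[symmetric])
qed

lemma energy_add_le: "energy b (\<lambda>x. f x + g x) \<le> 2 * (energy b f + energy b g)"
proof -
  have "energy b (\<lambda>x. f x + g x) = ennreal 4 * energy b (\<lambda>x. (f x + g x) / 2)"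
    using energy_scale[of 2 "\<lambda>x. (f x + g x) / 2"] by (simp del: distrib_left_numeral)
  also have "\<dots> \<le> ennreal 4 * ((energy b f + energy b g) / 2)"
    unfolding energy_parallelogram[of f g, symmetric] by (intro mult_left_mono) auto
  also have "\<dots> = 2 * (energy b f + energy b g)"
    by (simp only: ennreal_four_half ennreal_numeral)
  finally show ?thesis .
qed

lemma energy_diff_le:
  "energy b (\<lambda>x. f x - g x) \<le> 2 * (energy b (\<lambda>x. f x - h x) + energy b (\<lambda>x. h x - g x))"
  using energy_add_le[of "\<lambda>x. f x - h x" "\<lambda>x. h x - g x"] by simp

lemma edge_energy_contraction:
  assumes "\<And>s t. \<bar>C s - C t\<bar> \<le> \<bar>s - t :: real\<bar>"
  shows "edge_energy (\<lambda>x. C (f x)) p \<le> edge_energy f p"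
  unfolding edge_energy_def using assms
  by (intro divide_right_mono mult_left_mono) (auto simp: abs_le_square_iff[symmetric])

lemma energy_contraction:
  assumes "\<And>s t. \<bar>C s - C t\<bar> \<le> \<bar>s - t :: real\<bar>"
  shows "energy b (\<lambda>x. C (f x)) \<le> energy b f"
  unfolding energy_eq_nn_integral
  by (intro nn_integral_mono ennreal_leI edge_energy_contraction assms)

text \<open>The edge differences of \<open>C \<circ> f - C \<circ> F n\<close> are split into a part bounded by twice those of
  \<open>f\<close>, to which dominated convergence applies, and a part bounded by those of \<open>f - F n\<close>.\<close>

lemma energy_contraction_continuous:
  assumes C: "\<And>s t. \<bar>C s - C t\<bar> \<le> \<bar>s - t :: real\<bar>"
    and lim: "\<And>x. (\<lambda>n. F n x) \<longlonglongrightarrow> f x"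
    and fin: "energy b f < \<infinity>"
    and conv: "(\<lambda>n. energy b (\<lambda>x. f x - F n x)) \<longlonglongrightarrow> 0"
  shows "(\<lambda>n. energy b (\<lambda>x. C (f x) - C (F n x))) \<longlonglongrightarrow> 0"
proof -
  \<comment> \<open>\<open>d\<close> and \<open>r\<close> are the edge differences of
    \<open>C \<circ> f - C \<circ> F n\<close> and of \<open>f - F n\<close>. The excess
    \<open>e\<close> of \<open>d\<close> over \<open>r\<close> satisfies
    \<open>d \<le> e + r\<close>; it is the dominated part.\<close>
  define d where "d n p = \<bar>(C (f (fst p)) - C (F n (fst p))) - (C (f (snd p)) - C (F n (snd p)))\<bar>" for n p
  define r where "r n p = \<bar>(f (fst p) - F n (fst p)) - (f (snd p) - F n (snd p))\<bar>" for n p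
  define e where "e n p = max (d n p - r n p) 0" for n p
  define w where "w p = b (fst p) (snd p)" for p
  have d_le: "d n p \<le> 2 * \<bar>f (fst p) - f (snd p)\<bar> + r n p" for n p
    using C[of "f (fst p)" "f (snd p)"] C[of "F n (fst p)" "F n (snd p)"]
    unfolding d_def r_def by (smt (verit))
  have e_le: "e n p \<le> 2 * \<bar>f (fst p) - f (snd p)\<bar>" for n p
    using d_le[of n p] unfolding e_def by auto
  have e_nonneg: "0 \<le> e n p" for n p by (simp add: e_def)
  have contC: "continuous_on UNIV C"
    by (rule lipschitz_on_continuous_on[of 1]) (auto simp: lipschitz_on_def dist_real_def C)
  have limC: "(\<lambda>n. C (F n x)) \<longlonglongrightarrow> C (f x)" for x
    using continuous_on_tendsto_compose[OF contC lim] by simp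
  have d_lim: "(\<lambda>n. d n p) \<longlonglongrightarrow> 0" for p
  proof -
    have "(\<lambda>n. d n p) \<longlonglongrightarrow> \<bar>(C (f (fst p)) - C (f (fst p))) - (C (f (snd p)) - C (f (snd p)))\<bar>"
      unfolding d_def by (intro tendsto_intros limC)
    then show ?thesis by simp
  qed
  have e_lim: "(\<lambda>n. e n p) \<longlonglongrightarrow> 0" for p
    by (rule tendsto_sandwich[OF _ _ tendsto_const d_lim[of p]]) (auto simp: e_def d_def r_def intro!: always_eventually)
  have "(\<lambda>n. \<integral>\<^sup>+p. ennreal (w p * (e n p)\<^sup>2) \<partial>count_space UNIV) \<longlonglongrightarrow> (\<integral>\<^sup>+(p::'a\<times>'a). 0 \<partial>count_space UNIV)"
  proof (rule nn_integral_dominated_convergence)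
    \<comment> \<open>The 8 is 4 from squaring the factor 2 in \<open>e_le\<close>, times 2 to undo
      the 1/2 in \<open>edge_energy\<close>.\<close>
    show "AE p in count_space UNIV. ennreal (w p * (e n p)\<^sup>2) \<le> ennreal (8 * edge_energy f p)" for n
    proof (intro AE_I2 ennreal_leI)
      fix p
      have "(e n p)\<^sup>2 \<le> (2 * \<bar>f (fst p) - f (snd p)\<bar>)\<^sup>2"
        by (intro power_mono e_le e_nonneg)
      then have "w p * (e n p)\<^sup>2 \<le> w p * (2 * \<bar>f (fst p) - f (snd p)\<bar>)\<^sup>2"
        by (intro mult_left_mono) (auto simp: w_def)
      then show "w p * (e n p)\<^sup>2 \<le> 8 * edge_energy f p"
        by (simp add: w_def edge_energy_def power_mult_distrib algebra_simps)
    qed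
    show "(\<integral>\<^sup>+p. ennreal (8 * edge_energy f p) \<partial>count_space UNIV) < \<infinity>"
      using fin by (simp add: energy_eq_nn_integral ennreal_mult nn_integral_cmult ennreal_mult_less_top)
    show "AE p in count_space UNIV. (\<lambda>n. ennreal (w p * (e n p)\<^sup>2)) \<longlonglongrightarrow> 0"
    proof (intro AE_I2)
      fix p
      have "(\<lambda>n. w p * (e n p)\<^sup>2) \<longlonglongrightarrow> w p * 0\<^sup>2"
        by (intro tendsto_intros e_lim)
      then show "(\<lambda>n. ennreal (w p * (e n p)\<^sup>2)) \<longlonglongrightarrow> 0"
        using tendsto_ennrealI by fastforce
    qed
  qed auto
  then have lim1: "(\<lambda>n. \<integral>\<^sup>+p. ennreal (w p * (e n p)\<^sup>2) \<partial>count_space UNIV) \<longlonglongrightarrow> 0" by simp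
  have bound: "energy b (\<lambda>x. C (f x) - C (F n x))
      \<le> (\<integral>\<^sup>+p. ennreal (w p * (e n p)\<^sup>2) \<partial>count_space UNIV) + 2 * energy b (\<lambda>x. f x - F n x)" for n
  proof -
    have "edge_energy (\<lambda>x. C (f x) - C (F n x)) p \<le> w p * (e n p)\<^sup>2 + 2 * edge_energy (\<lambda>x. f x - F n x) p" for p
    proof -
      have "d n p \<le> e n p + r n p" by (simp add: e_def)
      then have "(d n p)\<^sup>2 \<le> (e n p + r n p)\<^sup>2" by (intro power_mono) (auto simp: d_def)
      also have "\<dots> \<le> 2 * (e n p)\<^sup>2 + 2 * (r n p)\<^sup>2"
        using sum_squares_bound[of "e n p" "r n p"] by (simp add: power2_sum)
      finally have "(d n p)\<^sup>2 / 2 \<le> (e n p)\<^sup>2 + (r n p)\<^sup>2" by simp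
      then have "w p * ((d n p)\<^sup>2 / 2) \<le> w p * ((e n p)\<^sup>2 + (r n p)\<^sup>2)"
        by (intro mult_left_mono) (auto simp: w_def)
      then show ?thesis
        by (simp add: w_def d_def r_def edge_energy_def algebra_simps)
    qed
    then have "ennreal (edge_energy (\<lambda>x. C (f x) - C (F n x)) p)
       \<le> ennreal (w p * (e n p)\<^sup>2) + 2 * ennreal (edge_energy (\<lambda>x. f x - F n x) p)" for p
      using ennreal_leI[of "edge_energy (\<lambda>x. C (f x) - C (F n x)) p"
          "w p * (e n p)\<^sup>2 + 2 * edge_energy (\<lambda>x. f x - F n x) p"]
      by (simp add: ennreal_plus ennreal_mult w_def)
    then show ?thesis
      unfolding energy_eq_nn_integral
      by (simp add: nn_integral_cmult[symmetric] nn_integral_add[symmetric] nn_integral_mono)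
  qed
  have "(\<lambda>n. (\<integral>\<^sup>+p. ennreal (w p * (e n p)\<^sup>2) \<partial>count_space UNIV) + 2 * energy b (\<lambda>x. f x - F n x))
     \<longlonglongrightarrow> 0 + 2 * 0"
    by (intro tendsto_intros lim1 ennreal_tendsto_cmult conv) auto
  then have "(\<lambda>n. (\<integral>\<^sup>+p. ennreal (w p * (e n p)\<^sup>2) \<partial>count_space UNIV) + 2 * energy b (\<lambda>x. f x - F n x))
     \<longlonglongrightarrow> 0" by simp
  from tendsto_sandwich[OF _ _ tendsto_const this] bound show ?thesis
    by (auto intro!: always_eventually)
qed

section \<open>The closure of the finitely supported functions\<close>

lemma Cc_add: "f \<in> Cc \<Longrightarrow> g \<in> Cc \<Longrightarrow> (\<lambda>x. f x + g x) \<in> Cc"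
  unfolding Cc_def mem_Collect_eq
  by (rule finite_subset[of _ "{x. f x \<noteq> 0} \<union> {x. g x \<noteq> 0}"]) auto

lemma Cc_comp: "f \<in> Cc \<Longrightarrow> C 0 = 0 \<Longrightarrow> (\<lambda>x. C (f x)) \<in> Cc"
  unfolding Cc_def mem_Collect_eq
  by (rule finite_subset[of _ "{x. f x \<noteq> 0}"]) auto

lemma finite_energy_add: "f \<in> finite_energy b \<Longrightarrow> g \<in> finite_energy b \<Longrightarrow> (\<lambda>x. f x + g x) \<in> finite_energy b"
  using le_less_trans[OF energy_add_le[of f g], of \<infinity>]
  by (simp add: finite_energy_def ennreal_mult_less_top)

lemma finite_energy_scale: "f \<in> finite_energy b \<Longrightarrow> (\<lambda>x. c * f x) \<in> finite_energy b"
  by (auto simp: finite_energy_def energy_scale ennreal_mult_less_top)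

text \<open>Only pairs in the row or the column of \<open>x\<close> contribute, each at most its
  weight, and by symmetry both have total weight equal to the finite degree of
  \<open>x\<close>.\<close>

lemma finite_energy_delta: "indicat_real {x} \<in> finite_energy b"
proof -
  let ?S = "(\<lambda>y. (x, y)) ` UNIV \<union> (\<lambda>y. (y, x)) ` UNIV"
  let ?g = "\<lambda>p. ennreal (b (fst p) (snd p))"
  have deg: "(\<integral>\<^sup>+y. ennreal (b x y) \<partial>count_space UNIV) < \<infinity>"
  proof -
    have "(\<integral>\<^sup>+y. ennreal (b x y) \<partial>count_space UNIV) = ennreal (infsum (b x) UNIV)"
      using infsum_nonneg_is_SUPREMUM_ennreal[of "b x" UNIV] b_summable[of x]
      by (simp add: infsum_ennreal_eq_nn_integral[symmetric] nonneg_infsum_complete)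
    then show ?thesis by simp
  qed
  have "energy b (indicat_real {x}) \<le>
     (\<integral>\<^sup>+p. ?g p * indicator (range (\<lambda>y. (x, y))) p + ?g p * indicator (range (\<lambda>y. (y, x))) p \<partial>count_space UNIV)"
    unfolding energy_eq_nn_integral
  proof (intro nn_integral_mono)
    fix p
    have "edge_energy (indicat_real {x}) p \<le> b (fst p) (snd p)"
      by (auto simp: edge_energy_def split: split_indicator)
    moreover have "edge_energy (indicat_real {x}) p = 0" if "fst p \<noteq> x" "snd p \<noteq> x"
      using that by (auto simp: edge_energy_def)
    moreover have "edge_energy (indicat_real {x}) p = 0" if "fst p = snd p"
      using that by (auto simp: edge_energy_def)
    ultimately show "ennreal (edge_energy (indicat_real {x}) p) \<le>
      ?g p * indicator (range (\<lambda>y. (x, y))) p + ?g p * indicator (range (\<lambda>y. (y, x))) p"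
      by (cases p) (auto split: split_indicator simp: ennreal_leI intro: add_increasing2)
  qed
  also have "\<dots> = (\<integral>\<^sup>+p. ?g p \<partial>count_space (range (\<lambda>y. (x, y)))) + (\<integral>\<^sup>+p. ?g p \<partial>count_space (range (\<lambda>y. (y, x))))"
    by (subst nn_integral_add) (auto simp: nn_integral_restrict_space[symmetric] restrict_count_space)
  also have "(\<integral>\<^sup>+p. ?g p \<partial>count_space (range (\<lambda>y. (x, y)))) = (\<integral>\<^sup>+y. ennreal (b x y) \<partial>count_space UNIV)"
    by (subst nn_integral_bij_count_space[symmetric, of "\<lambda>y. (x, y)" UNIV])
       (auto simp: bij_betw_def inj_on_def)
  also have "(\<integral>\<^sup>+p. ?g p \<partial>count_space (range (\<lambda>y. (y, x)))) = (\<integral>\<^sup>+y. ennreal (b x y) \<partial>count_space UNIV)"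
    by (subst nn_integral_bij_count_space[symmetric, of "\<lambda>y. (y, x)" UNIV])
       (auto simp: bij_betw_def inj_on_def b_sym)
  finally have le: "energy b (indicat_real {x}) \<le>
    (\<integral>\<^sup>+y. ennreal (b x y) \<partial>count_space UNIV) + (\<integral>\<^sup>+y. ennreal (b x y) \<partial>count_space UNIV)" .
  show ?thesis using le_less_trans[OF le, of \<infinity>] deg by (simp add: finite_energy_def)
qed

lemma Cc_finite_energy:
  assumes "f \<in> Cc"
  shows "f \<in> finite_energy b"
proof -
  have "(\<lambda>x. \<Sum>y\<in>S. f y * indicat_real {y} x) \<in> finite_energy b" if "finite S" for S
    using that
  proof (induction S rule: finite_induct)
    case empty
    then show ?case by (simp add: finite_energy_def energy_eq_nn_integral edge_energy_def)
  next
    case (insert y S)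
    show ?case
      unfolding sum.insert[OF insert(1,2)]
      by (rule finite_energy_add[OF finite_energy_scale[OF finite_energy_delta] insert(3)])
  qed
  from this[of "{x. f x \<noteq> 0}"] assms
  have "(\<lambda>x. \<Sum>y | f y \<noteq> 0. f y * indicat_real {y} x) \<in> finite_energy b" by (simp add: Cc_def)
  moreover have "(\<Sum>y | f y \<noteq> 0. f y * indicat_real {y} x) = f x" for x
    using assms by (cases "f x = 0") (auto simp: Cc_def indicator_def if_distrib cong: if_cong)
  ultimately show ?thesis by simp
qed

lemma finite_energy0I:
  assumes "f \<in> finite_energy b" "\<And>n. F n \<in> Cc" "\<And>x. (\<lambda>n. F n x) \<longlonglongrightarrow> f x"
    "(\<lambda>n. energy b (\<lambda>x. f x - F n x)) \<longlonglongrightarrow> 0"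
  shows "f \<in> finite_energy0 b"
  unfolding finite_energy0_def using assms by blast

lemma finite_energy0D:
  assumes "f \<in> finite_energy0 b"
  shows "\<exists>F. f \<in> finite_energy b \<and> (\<forall>n. F n \<in> Cc) \<and> (\<forall>x. (\<lambda>n. F n x) \<longlonglongrightarrow> f x) \<and>
    (\<lambda>n. energy b (\<lambda>x. f x - F n x)) \<longlonglongrightarrow> 0"
  using assms unfolding finite_energy0_def by blast

lemma energy_zero: "energy b (\<lambda>x. 0) = 0"
  by (simp add: energy_eq_nn_integral edge_energy_def)

lemma Cc_finite_energy0: "f \<in> Cc \<Longrightarrow> f \<in> finite_energy0 b"
  by (rule finite_energy0I[of f "\<lambda>_. f"]) (auto simp: Cc_finite_energy energy_zero)

lemma finite_energy0_add:
  assumes "f \<in> finite_energy0 b" "g \<in> finite_energy0 b"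
  shows "(\<lambda>x. f x + g x) \<in> finite_energy0 b"
proof -
  obtain F where "f \<in> finite_energy b \<and> (\<forall>n. F n \<in> Cc) \<and> (\<forall>x. (\<lambda>n. F n x) \<longlonglongrightarrow> f x) \<and>
      (\<lambda>n. energy b (\<lambda>x. f x - F n x)) \<longlonglongrightarrow> 0"
    using finite_energy0D[OF assms(1)] by blast
  then have F: "f \<in> finite_energy b" "\<And>n. F n \<in> Cc" "\<And>x. (\<lambda>n. F n x) \<longlonglongrightarrow> f x"
    "(\<lambda>n. energy b (\<lambda>x. f x - F n x)) \<longlonglongrightarrow> 0" by auto
  obtain G where "g \<in> finite_energy b \<and> (\<forall>n. G n \<in> Cc) \<and> (\<forall>x. (\<lambda>n. G n x) \<longlonglongrightarrow> g x) \<and>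
      (\<lambda>n. energy b (\<lambda>x. g x - G n x)) \<longlonglongrightarrow> 0"
    using finite_energy0D[OF assms(2)] by blast
  then have G: "g \<in> finite_energy b" "\<And>n. G n \<in> Cc" "\<And>x. (\<lambda>n. G n x) \<longlonglongrightarrow> g x"
    "(\<lambda>n. energy b (\<lambda>x. g x - G n x)) \<longlonglongrightarrow> 0" by auto
  show ?thesis
  proof (rule finite_energy0I)
    have "(\<lambda>n. 2 * (energy b (\<lambda>x. f x - F n x) + energy b (\<lambda>x. g x - G n x))) \<longlonglongrightarrow> 2 * (0 + 0)"
      by (intro ennreal_tendsto_cmult tendsto_intros F G) auto
    then have lim: "(\<lambda>n. 2 * (energy b (\<lambda>x. f x - F n x) + energy b (\<lambda>x. g x - G n x))) \<longlonglongrightarrow> 0"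
      by simp
    have "energy b (\<lambda>x. f x + g x - (F n x + G n x))
      \<le> 2 * (energy b (\<lambda>x. f x - F n x) + energy b (\<lambda>x. g x - G n x))" for n
      using energy_add_le[of "\<lambda>x. f x - F n x" "\<lambda>x. g x - G n x"] by (simp add: algebra_simps)
    with tendsto_sandwich[OF _ _ tendsto_const lim]
    show "(\<lambda>n. energy b (\<lambda>x. f x + g x - (F n x + G n x))) \<longlonglongrightarrow> 0"
      by (auto intro!: always_eventually)
    show "(\<lambda>n. F n x + G n x) \<longlonglongrightarrow> f x + g x" for x
      by (intro tendsto_intros F G)
  qed (use F G in \<open>auto intro: Cc_add finite_energy_add\<close>)
qed

text \<open>If \<open>F n\<close> approximates \<open>f\<close>, then \<open>C \<circ> F n\<close>
  approximates \<open>C \<circ> f\<close>: the support stays finite because \<open>C 0 = 0\<close>,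
  and the energies converge by \<open>energy_contraction_continuous\<close>. It is applied to
  halving and to truncation.\<close>

lemma finite_energy0_contraction:
  assumes C: "\<And>s t. \<bar>C s - C t\<bar> \<le> \<bar>s - t :: real\<bar>" "C 0 = 0"
    and f: "f \<in> finite_energy0 b"
  shows "(\<lambda>x. C (f x)) \<in> finite_energy0 b"
proof -
  obtain F where "f \<in> finite_energy b \<and> (\<forall>n. F n \<in> Cc) \<and> (\<forall>x. (\<lambda>n. F n x) \<longlonglongrightarrow> f x) \<and>
      (\<lambda>n. energy b (\<lambda>x. f x - F n x)) \<longlonglongrightarrow> 0"
    using finite_energy0D[OF f] by blast
  then have F: "f \<in> finite_energy b" "\<And>n. F n \<in> Cc" "\<And>x. (\<lambda>n. F n x) \<longlonglongrightarrow> f x"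
    "(\<lambda>n. energy b (\<lambda>x. f x - F n x)) \<longlonglongrightarrow> 0" by auto
  have contC: "continuous_on UNIV C"
    by (rule lipschitz_on_continuous_on[of 1]) (simp_all add: lipschitz_on_def dist_real_def C(1))
  show ?thesis
  proof (rule finite_energy0I)
    show "(\<lambda>x. C (f x)) \<in> finite_energy b"
      using F(1) le_less_trans[OF energy_contraction[of C f, OF C(1)], of \<infinity>] by (simp add: finite_energy_def)
    show "(\<lambda>n. C (F n x)) \<longlonglongrightarrow> C (f x)" for x
      using continuous_on_tendsto_compose[OF contC F(3)] by simp
    show "(\<lambda>n. energy b (\<lambda>x. C (f x) - C (F n x))) \<longlonglongrightarrow> 0"
      using F(1) by (intro energy_contraction_continuous[of C, OF C(1) F(3) _ F(4)]) (simp_all add: finite_energy_def)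
    show "(\<lambda>x. C (F n x)) \<in> Cc" for n
      by (rule Cc_comp[of "F n" C, OF F(2) C(2)])
  qed
qed

lemma finite_energy0_half: "f \<in> finite_energy0 b \<Longrightarrow> (\<lambda>x. f x / 2) \<in> finite_energy0 b"
  by (rule finite_energy0_contraction[of "\<lambda>s. s / 2"]) auto

lemma finite_energy0_approx:
  assumes "f \<in> finite_energy0 b" "finite S" "0 < (e::real)"
  shows "\<exists>v\<in>Cc. energy b (\<lambda>x. f x - v x) < ennreal e \<and> (\<forall>x\<in>S. \<bar>v x - f x\<bar> < e)"
proof -
  obtain F where "f \<in> finite_energy b \<and> (\<forall>n. F n \<in> Cc) \<and> (\<forall>x. (\<lambda>n. F n x) \<longlonglongrightarrow> f x) \<and>
      (\<lambda>n. energy b (\<lambda>x. f x - F n x)) \<longlonglongrightarrow> 0"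
    using finite_energy0D[OF assms(1)] by blast
  then have F: "\<And>n. F n \<in> Cc" "\<And>x. (\<lambda>n. F n x) \<longlonglongrightarrow> f x"
    "(\<lambda>n. energy b (\<lambda>x. f x - F n x)) \<longlonglongrightarrow> 0" by auto
  have "\<forall>\<^sub>F k in sequentially. energy b (\<lambda>x. f x - F k x) < ennreal e"
    by (rule order_tendstoD(2)[OF F(3)]) (simp add: assms)
  moreover have "\<forall>\<^sub>F k in sequentially. \<forall>x\<in>S. \<bar>F k x - f x\<bar> < e"
  proof (intro eventually_ball_finite assms ballI)
    fix x show "\<forall>\<^sub>F k in sequentially. \<bar>F k x - f x\<bar> < e"
      using tendstoD[OF F(2)[of x], of e] assms by (simp add: dist_real_def)
  qed
  ultimately have "\<forall>\<^sub>F k in sequentially. energy b (\<lambda>x. f x - F k x) < ennreal e \<and>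
      (\<forall>x\<in>S. \<bar>F k x - f x\<bar> < e)" by (rule eventually_conj)
  from eventually_happens'[OF sequentially_bot this] obtain k
    where "energy b (\<lambda>x. f x - F k x) < ennreal e \<and> (\<forall>x\<in>S. \<bar>F k x - f x\<bar> < e)" ..
  then show ?thesis using F(1)[of k] by (intro bexI[of _ "F k"])
qed

text \<open>Diagonal argument: \<open>V n\<close> in \<open>Cc\<close> is chosen within 1/(n+1) of
  \<open>U n\<close>, both in energy and at the first n vertices of the enumeration. Every vertex is
  eventually among these, so \<open>V n\<close> converges pointwise and in energy to
  \<open>u\<close>.\<close>

lemma finite_energy0_closed:
  assumes u: "\<And>n. U n \<in> finite_energy0 b" and lim: "\<And>x. (\<lambda>n. U n x) \<longlonglongrightarrow> u x"
    and conv: "(\<lambda>n. energy b (\<lambda>x. u x - U n x)) \<longlonglongrightarrow> 0"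
  shows "u \<in> finite_energy0 b"
proof -
  have "\<exists>v\<in>Cc. energy b (\<lambda>x. U n x - v x) < ennreal (1 / Suc n) \<and>
      (\<forall>x\<in>{x. to_nat x < n}. \<bar>v x - U n x\<bar> < 1 / Suc n)" for n
    by (intro finite_energy0_approx u finite_to_nat_less) simp
  then have "\<exists>V. \<forall>n. V n \<in> Cc \<and> energy b (\<lambda>x. U n x - V n x) < ennreal (1 / Suc n) \<and>
      (\<forall>x\<in>{x. to_nat x < n}. \<bar>V n x - U n x\<bar> < 1 / Suc n)"
    by (intro choice allI) blast
  then obtain V where V: "\<And>n. V n \<in> Cc" "\<And>n. energy b (\<lambda>x. U n x - V n x) < ennreal (1 / Suc n)"
    "\<And>n x. to_nat x < n \<Longrightarrow> \<bar>V n x - U n x\<bar> < 1 / Suc n"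
    by blast
  have inv: "(\<lambda>n. 1 / real (Suc n)) \<longlonglongrightarrow> 0" by (rule LIMSEQ_Suc[OF lim_1_over_n])
  have lim0: "(\<lambda>n. 2 * (energy b (\<lambda>x. u x - U n x) + ennreal (1 / Suc n))) \<longlonglongrightarrow> 0"
  proof -
    have "(\<lambda>n. 2 * (energy b (\<lambda>x. u x - U n x) + ennreal (1 / Suc n))) \<longlonglongrightarrow> 2 * (0 + ennreal 0)"
      by (intro ennreal_tendsto_cmult tendsto_intros conv tendsto_ennrealI inv) auto
    then show ?thesis by simp
  qed
  have bound: "energy b (\<lambda>x. u x - V n x) \<le> 2 * (energy b (\<lambda>x. u x - U n x) + ennreal (1 / Suc n))" for n
    using energy_diff_le[of u "V n" "U n"] V(2)[of n]
    by (meson add_left_mono less_imp_le mult_left_mono order_trans zero_le)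
  have conv': "(\<lambda>n. energy b (\<lambda>x. u x - V n x)) \<longlonglongrightarrow> 0"
    using tendsto_sandwich[OF _ _ tendsto_const lim0] bound by (auto intro!: always_eventually)
  show ?thesis
  proof (rule finite_energy0I[OF _ V(1) _ conv'])
    \<comment> \<open>Finite energy of \<open>u\<close> comes from writing it as
      \<open>(u - V n) + V n\<close> for a single \<open>n\<close> at which the first part has
      energy below 1.\<close>
    obtain n where "energy b (\<lambda>x. u x - V n x) < 1"
      using order_tendstoD(2)[OF conv', of 1] eventually_happens' sequentially_bot by force
    then have "(\<lambda>x. u x - V n x) \<in> finite_energy b"
      using less_trans[of _ "1::ennreal" \<infinity>] by (simp add: finite_energy_def)
    from finite_energy_add[OF this Cc_finite_energy[OF V(1)[of n]]]
    show "u \<in> finite_energy b" by simp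
    fix x
    have "(\<lambda>n. V n x - U n x) \<longlonglongrightarrow> 0"
    proof (rule Lim_null_comparison[OF _ inv])
      show "\<forall>\<^sub>F n in sequentially. norm (V n x - U n x) \<le> 1 / real (Suc n)"
        using eventually_gt_at_top[of "to_nat x"] by eventually_elim (use V(3) in force)
    qed
    from tendsto_add[OF this lim[of x]] show "(\<lambda>n. V n x) \<longlonglongrightarrow> u x" by simp
  qed
qed

end

section \<open>The functional and its minimizer\<close>

lemma primitive2_has_derivative:
  assumes "continuous_on UNIV \<phi>"
  shows "(primitive2 \<phi> has_real_derivative 2 * \<phi> s) (at s)"
proof -
  \<comment> \<open>The interval contains the base point 0 and has \<open>s\<close> in its interior,
    so the derivative within it is the two-sided one.\<close>
  let ?a = "min 0 s - 1" and ?b = "max 0 s + 1"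
  have "((\<lambda>u. LBINT y=(0::real)..u. 2 * \<phi> y) has_vector_derivative 2 * \<phi> s) (at s within {?a..?b})"
    by (rule interval_integral_FTC2) (auto intro!: continuous_intros continuous_on_subset[OF assms])
  then show ?thesis
    by (subst (asm) at_within_interior)
       (auto simp: primitive2_def[abs_def] has_real_derivative_iff_has_vector_derivative zero_ereal_def)
qed

text \<open>The tail infima increase, so their suprema can be added termwise. This combines the
  semicontinuity of \<open>energy\<close> and of \<open>kappa\<close>.\<close>

lemma liminf_add_le_ennreal:
  fixes f g :: "nat \<Rightarrow> ennreal"
  shows "liminf f + liminf g \<le> liminf (\<lambda>n. f n + g n)"
proof -
  have "liminf f + liminf g = (SUP n. (INF i\<in>{n..}. f i) + (INF i\<in>{n..}. g i))"
    unfolding liminf_SUP_INF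
    by (rule ennreal_SUP_add[symmetric]) (auto simp: incseq_def intro!: INF_superset_mono)
  also have "\<dots> \<le> liminf (\<lambda>n. f n + g n)"
    unfolding liminf_SUP_INF
    by (intro SUP_mono' INF_greatest add_mono INF_lower)
  finally show ?thesis .
qed

lemma liminf_le_ennreal:
  fixes f :: "nat \<Rightarrow> ennreal"
  assumes "\<forall>\<^sub>F n in sequentially. f n \<le> c"
  shows "liminf f \<le> c"
  using Liminf_mono[OF assms] by (simp add: Liminf_const)

locale nonlinear_graph = graph b for b :: "'a::countable \<Rightarrow> 'a \<Rightarrow> real" +
  fixes m W :: "'a \<Rightarrow> real" and \<phi> :: "real \<Rightarrow> real"
  assumes m_pos: "0 < m x"
    and phi_cont: "continuous_on UNIV \<phi>"
    and phi_mono: "strict_mono \<phi>"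
    and phi_0: "\<phi> 0 = 0"
    and W_pos: "0 < W x"
begin

section \<open>Convexity of the potential \<Phi>\<close>

lemma phi_pos: "0 < s \<Longrightarrow> 0 < \<phi> s" and phi_neg: "s < 0 \<Longrightarrow> \<phi> s < 0"
  using strict_monoD[OF phi_mono, of 0 s] strict_monoD[OF phi_mono, of s 0] by (simp_all add: phi_0)

lemma phi_nonneg: "0 \<le> s \<Longrightarrow> 0 \<le> \<phi> s"
  using phi_pos[of s] phi_0 by (cases "s = 0") auto

lemma phi_nonpos: "s \<le> 0 \<Longrightarrow> \<phi> s \<le> 0"
  using phi_neg[of s] phi_0 by (cases "s = 0") auto

abbreviation \<Phi> :: "real \<Rightarrow> real" where "\<Phi> \<equiv> primitive2 \<phi>"

lemmas Phi_deriv = primitive2_has_derivative[OF phi_cont]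

lemma Phi_0: "\<Phi> 0 = 0"
  by (simp add: primitive2_def zero_ereal_def)

lemma isCont_Phi: "isCont \<Phi> s"
  using Phi_deriv DERIV_isCont by blast

lemma Phi_mono_nonneg: "0 \<le> s \<Longrightarrow> s \<le> t \<Longrightarrow> \<Phi> s \<le> \<Phi> t"
  by (rule DERIV_nonneg_imp_nondecreasing) (use Phi_deriv phi_nonneg in \<open>auto intro!: exI\<close>)

lemma Phi_antimono_nonpos: "s \<le> t \<Longrightarrow> t \<le> 0 \<Longrightarrow> \<Phi> t \<le> \<Phi> s"
  by (rule DERIV_nonpos_imp_nonincreasing) (use Phi_deriv phi_nonpos in \<open>auto intro!: exI\<close>)

lemma Phi_nonneg: "0 \<le> \<Phi> s"
  using Phi_mono_nonneg[of 0 s] Phi_antimono_nonpos[of s 0] Phi_0 by (cases "0 \<le> s") auto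

text \<open>By the mean value theorem on the two halves of the interval, \<Phi> has a strictly
  larger slope on the right half, since \<phi> is strictly increasing; the halves have equal
  length.\<close>

lemma Phi_strict_midpoint_aux:
  assumes "s < t"
  shows "\<Phi> ((s + t) / 2) < (\<Phi> s + \<Phi> t) / 2"
proof -
  let ?c = "(s + t) / 2"
  have "s < ?c" "?c < t" using assms by auto
  obtain z1 where z1: "s < z1" "z1 < ?c" "\<Phi> ?c - \<Phi> s = (?c - s) * (2 * \<phi> z1)"
    using MVT2[OF \<open>s < ?c\<close>, of \<Phi> "\<lambda>t. 2 * \<phi> t"] Phi_deriv by blast
  obtain z2 where z2: "?c < z2" "z2 < t" "\<Phi> t - \<Phi> ?c = (t - ?c) * (2 * \<phi> z2)"
    using MVT2[OF \<open>?c < t\<close>, of \<Phi> "\<lambda>t. 2 * \<phi> t"] Phi_deriv by blast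
  have "\<phi> z1 < \<phi> z2" using z1 z2 by (intro strict_monoD[OF phi_mono]) simp
  then have "(?c - s) * (2 * \<phi> z1) < (?c - s) * (2 * \<phi> z2)"
    using \<open>s < ?c\<close> by simp
  moreover have "?c - s = t - ?c" by (simp add: field_simps)
  ultimately have "\<Phi> ?c - \<Phi> s < \<Phi> t - \<Phi> ?c" using z1(3) z2(3) by metis
  then show ?thesis by simp
qed

lemma Phi_strict_midpoint: "s \<noteq> t \<Longrightarrow> \<Phi> ((s + t) / 2) < (\<Phi> s + \<Phi> t) / 2"
  using Phi_strict_midpoint_aux[of s t] Phi_strict_midpoint_aux[of t s]
  by (cases "s < t") (simp_all add: add.commute)

lemma Phi_midpoint: "\<Phi> ((s + t) / 2) \<le> (\<Phi> s + \<Phi> t) / 2"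
  using Phi_strict_midpoint[of s t] by (cases "s = t") auto

section \<open>Midpoint convexity of the functional\<close>

definition kappa_term :: "('a \<Rightarrow> real) \<Rightarrow> ('a \<Rightarrow> real) \<Rightarrow> 'a \<Rightarrow> real" where
  "kappa_term f u x = \<Phi> (f x - W x * u x) * (m x / W x)"

lemma mW_pos: "0 < m x / W x"
  using m_pos W_pos by simp

lemma kappa_term_nonneg: "0 \<le> kappa_term f u x"
  unfolding kappa_term_def using mW_pos[of x] Phi_nonneg by (intro mult_nonneg_nonneg) auto

lemma kappa_eq_nn_integral: "kappa m \<phi> W f u = (\<integral>\<^sup>+x. ennreal (kappa_term f u x) \<partial>count_space UNIV)"
  by (simp add: kappa_def kappa_term_def infsum_ennreal_eq_nn_integral)

lemma kappa_term_midpoint: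
  "kappa_term f (\<lambda>x. (u x + v x) / 2) x \<le> (kappa_term f u x + kappa_term f v x) / 2"
  and kappa_term_strict_midpoint:
  "u x \<noteq> v x \<Longrightarrow> kappa_term f (\<lambda>x. (u x + v x) / 2) x < (kappa_term f u x + kappa_term f v x) / 2"
proof -
  have eq: "f x - W x * ((u x + v x) / 2) = ((f x - W x * u x) + (f x - W x * v x)) / 2"
    by (simp add: field_simps)
  have eq2: "(kappa_term f u x + kappa_term f v x) / 2 =
    (\<Phi> (f x - W x * u x) + \<Phi> (f x - W x * v x)) / 2 * (m x / W x)"
    by (simp add: kappa_term_def algebra_simps add_divide_distrib)
  show "kappa_term f (\<lambda>x. (u x + v x) / 2) x \<le> (kappa_term f u x + kappa_term f v x) / 2"
    unfolding eq2 unfolding kappa_term_def eq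
    by (intro mult_right_mono Phi_midpoint less_imp_le[OF mW_pos])
  show "kappa_term f (\<lambda>x. (u x + v x) / 2) x < (kappa_term f u x + kappa_term f v x) / 2" if "u x \<noteq> v x"
    unfolding eq2 unfolding kappa_term_def eq
    using that W_pos[of x] by (intro mult_strict_right_mono Phi_strict_midpoint mW_pos) auto
qed

text \<open>A convexity gap \<delta> at the single vertex \<open>x\<close> survives in the sum,
  because convexity gives a gap of at least 0 at all other vertices. Taking \<delta> = 0 yields
  plain midpoint convexity.\<close>

lemma kappa_midpoint_gap:
  assumes "0 \<le> \<delta>" "kappa_term f (\<lambda>x. (u x + v x) / 2) x + \<delta> \<le> (kappa_term f u x + kappa_term f v x) / 2"
  shows "kappa m \<phi> W f (\<lambda>x. (u x + v x) / 2) + ennreal \<delta> \<le> (kappa m \<phi> W f u + kappa m \<phi> W f v) / 2"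
proof -
  let ?w = "\<lambda>x. (u x + v x) / 2"
  have "kappa m \<phi> W f ?w + ennreal \<delta> =
      (\<integral>\<^sup>+y. ennreal (kappa_term f ?w y) + ennreal \<delta> * indicator {x} y \<partial>count_space UNIV)"
    by (simp add: kappa_eq_nn_integral nn_integral_add)
  also have "\<dots> \<le> (\<integral>\<^sup>+y. (ennreal (kappa_term f u y) + ennreal (kappa_term f v y)) / 2 \<partial>count_space UNIV)"
  proof (intro nn_integral_mono)
    fix y
    have "kappa_term f ?w y + \<delta> * indicator {x} y \<le> (kappa_term f u y + kappa_term f v y) / 2"
      using assms kappa_term_midpoint[of f u v y] by (auto split: split_indicator)
    then have "ennreal (kappa_term f ?w y + \<delta> * indicator {x} y) \<le> ennreal ((kappa_term f u y + kappa_term f v y) / 2)"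
      by (rule ennreal_leI)
    also have "ennreal ((kappa_term f u y + kappa_term f v y) / 2) = (ennreal (kappa_term f u y) + ennreal (kappa_term f v y)) / 2"
      by (metis (no_types, lifting) add_nonneg_nonneg divide_ennreal kappa_term_nonneg ennreal_numeral
          ennreal_plus zero_le_numeral zero_less_numeral)
    finally show "ennreal (kappa_term f ?w y) + ennreal \<delta> * indicator {x} y
      \<le> (ennreal (kappa_term f u y) + ennreal (kappa_term f v y)) / 2"
      using assms(1) by (auto split: split_indicator simp: ennreal_plus kappa_term_nonneg)
  qed
  also have "\<dots> = (kappa m \<phi> W f u + kappa m \<phi> W f v) / 2"
    by (simp add: kappa_eq_nn_integral nn_integral_add nn_integral_divide)
  finally show ?thesis .
qed

abbreviation "fdom f \<equiv> functional_domain b m \<phi> W f"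
abbreviation "fnl f \<equiv> functional b m \<phi> W f"

lemma fnl_finite: "u \<in> fdom f \<Longrightarrow> fnl f u < \<infinity>"
  by (simp add: functional_domain_def functional_def finite_energy0_def finite_energy_def)

lemma dom_midpoint:
  assumes "u \<in> fdom f" "v \<in> fdom f"
  shows "(\<lambda>x. (u x + v x) / 2) \<in> fdom f"
proof -
  have "kappa m \<phi> W f (\<lambda>x. (u x + v x) / 2) \<le> (kappa m \<phi> W f u + kappa m \<phi> W f v) / 2"
    \<comment> \<open>With gap 0 any vertex serves, hence \<open>undefined\<close>.\<close>
    using kappa_midpoint_gap[of 0 f u v undefined] kappa_term_midpoint by simp
  also have "\<dots> < \<infinity>"
  proof -
    have "inverse (ennreal 2) < top"
      using inverse_ennreal[of 2] ennreal_less_top[of "inverse 2"] by argo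
    then show "(kappa m \<phi> W f u + kappa m \<phi> W f v) / 2 < \<infinity>"
      using assms
      by (simp add: functional_domain_def divide_ennreal_def ennreal_mult_less_top)
  qed
  finally have "kappa m \<phi> W f (\<lambda>x. (u x + v x) / 2) < \<infinity>" .
  then show ?thesis
    using assms finite_energy0_half[OF finite_energy0_add[of u v]]
    by (simp add: functional_domain_def)
qed

text \<open>The midpoint gains twice: the parallelogram term from the energy and \<delta> from
  \<open>kappa\<close>. A positive \<delta> gives uniqueness of minimizers, and \<delta> = 0 the
  Cauchy estimate for minimizing sequences.\<close>

lemma fnl_midpoint_gap:
  assumes "0 \<le> \<delta>" "kappa_term f (\<lambda>x. (u x + v x) / 2) x + \<delta> \<le> (kappa_term f u x + kappa_term f v x) / 2"
  shows "fnl f (\<lambda>x. (u x + v x) / 2) + energy b (\<lambda>x. (u x - v x) / 2) + ennreal \<delta> \<le> (fnl f u + fnl f v) / 2"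
proof -
  have "fnl f (\<lambda>x. (u x + v x) / 2) + energy b (\<lambda>x. (u x - v x) / 2) + ennreal \<delta> =
    (energy b u + energy b v) / 2 + (kappa m \<phi> W f (\<lambda>x. (u x + v x) / 2) + ennreal \<delta>)"
    unfolding energy_parallelogram[symmetric] functional_def by (simp add: ac_simps)
  also have "\<dots> \<le> (energy b u + energy b v) / 2 + (kappa m \<phi> W f u + kappa m \<phi> W f v) / 2"
    by (intro add_left_mono kappa_midpoint_gap[of \<delta> f u v x] assms)
  also have "\<dots> = (fnl f u + fnl f v) / 2"
    by (simp add: functional_def divide_ennreal_def algebra_simps)
  finally show ?thesis .
qed

section \<open>Uniqueness of the minimizer\<close>

definition is_minimizer :: "('a \<Rightarrow> real) \<Rightarrow> ('a \<Rightarrow> real) \<Rightarrow> bool" where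
  "is_minimizer f u \<longleftrightarrow> u \<in> fdom f \<and> (\<forall>v\<in>fdom f. fnl f u \<le> fnl f v)"

lemma ennreal_half_double: "((c::ennreal) + c) / 2 = c"
proof (cases c)
  case (real r)
  then have "(c + c) / 2 = ennreal (r + r) / ennreal 2"
    by (simp only: ennreal_plus ennreal_numeral)
  also have "\<dots> = ennreal ((r + r) / 2)" using real by (intro divide_ennreal) auto
  finally show ?thesis using real by simp
qed (simp add: divide_ennreal_def ennreal_top_mult)

text \<open>At a vertex where two minimizers differ, strict convexity of \<Phi> gives a gap \<delta>
  > 0, so their midpoint would lie below the minimum. The finite minimal value can be cancelled to
  reach the contradiction.\<close>

lemma is_minimizer_unique:
  assumes u: "is_minimizer f u" and v: "is_minimizer f v"
  shows "u = v"
proof (rule ccontr)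
  assume "u \<noteq> v"
  then obtain x where "u x \<noteq> v x" by blast
  let ?w = "\<lambda>x. (u x + v x) / 2"
  define \<delta> where "\<delta> = (kappa_term f u x + kappa_term f v x) / 2 - kappa_term f ?w x"
  have "\<delta> > 0" using kappa_term_strict_midpoint[of u x v f, OF \<open>u x \<noteq> v x\<close>] by (simp add: \<delta>_def)
  have "fnl f u = fnl f v" using u v by (auto simp: is_minimizer_def intro: antisym)
  have wdom: "?w \<in> fdom f" using u v by (intro dom_midpoint) (auto simp: is_minimizer_def)
  have "fnl f u + ennreal \<delta> \<le> fnl f ?w + ennreal \<delta>"
    using u wdom by (intro add_right_mono) (simp add: is_minimizer_def)
  also have "\<dots> \<le> fnl f ?w + energy b (\<lambda>x. (u x - v x) / 2) + ennreal \<delta>"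
    by (intro add_right_mono) simp
  also have "\<dots> \<le> (fnl f u + fnl f v) / 2"
    using \<open>\<delta> > 0\<close> by (intro fnl_midpoint_gap[of \<delta> f u v x]) (auto simp: \<delta>_def)
  also have "\<dots> = fnl f u + 0"
    using \<open>fnl f u = fnl f v\<close> ennreal_half_double by simp
  finally have "ennreal \<delta> \<le> 0"
    by (rule ennreal_add_le_imp_le) (use fnl_finite u in \<open>simp add: is_minimizer_def\<close>)
  then show False using \<open>\<delta> > 0\<close> by simp
qed

section \<open>Truncation at 0 and \<alpha>\<close>

definition clamp :: "real \<Rightarrow> real \<Rightarrow> real" where "clamp \<alpha> s = max 0 (min \<alpha> s)"

lemma clamp_lipschitz: "\<bar>clamp \<alpha> s - clamp \<alpha> t\<bar> \<le> \<bar>s - t\<bar>"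
  by (simp add: clamp_def max_def min_def)

text \<open>Since \<open>0 \<le> f x \<le> \<alpha> * W x\<close>, truncating \<open>u x\<close>
  moves \<open>f x - W x * u x\<close> towards 0 without crossing it: from above if
  \<open>u x < 0\<close>, from below if \<open>u x > \<alpha>\<close>. \<Phi> decreases towards 0
  from either side.\<close>

lemma kappa_term_clamp:
  assumes "0 \<le> \<alpha>" "0 \<le> f x" "f x \<le> \<alpha> * W x"
  shows "kappa_term f (\<lambda>x. clamp \<alpha> (u x)) x \<le> kappa_term f u x"
  unfolding kappa_term_def
proof (intro mult_right_mono less_imp_le[OF mW_pos])
  consider "u x < 0" | "0 \<le> u x" "u x \<le> \<alpha>" | "\<alpha> < u x" by linarith
  then show "\<Phi> (f x - W x * clamp \<alpha> (u x)) \<le> \<Phi> (f x - W x * u x)"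
  proof cases
    case 1
    then have "W x * u x \<le> 0" using W_pos[of x] by (simp add: mult_le_0_iff)
    with 1 assms show ?thesis by (auto simp: clamp_def intro!: Phi_mono_nonneg)
  next
    case 2
    then show ?thesis by (simp add: clamp_def)
  next
    case 3
    then have "W x * \<alpha> \<le> W x * u x" using W_pos[of x] by simp
    with 3 assms show ?thesis by (auto simp: clamp_def mult.commute intro!: Phi_antimono_nonpos)
  qed
qed

lemma clamp_dom:
  assumes "0 < \<alpha>" "\<And>x. 0 \<le> f x" "\<And>x. f x \<le> \<alpha> * W x" "u \<in> fdom f"
  shows "(\<lambda>x. clamp \<alpha> (u x)) \<in> fdom f" "fnl f (\<lambda>x. clamp \<alpha> (u x)) \<le> fnl f u"
proof -
  have k: "kappa m \<phi> W f (\<lambda>x. clamp \<alpha> (u x)) \<le> kappa m \<phi> W f u"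
    unfolding kappa_eq_nn_integral using assms
    by (intro nn_integral_mono ennreal_leI kappa_term_clamp) auto
  have "(\<lambda>x. clamp \<alpha> (u x)) \<in> finite_energy0 b"
    by (rule finite_energy0_contraction[OF clamp_lipschitz])
       (use assms in \<open>auto simp: clamp_def functional_domain_def\<close>)
  with k assms(4) show "(\<lambda>x. clamp \<alpha> (u x)) \<in> fdom f"
    by (auto simp: functional_domain_def intro: le_less_trans)
  show "fnl f (\<lambda>x. clamp \<alpha> (u x)) \<le> fnl f u"
    unfolding functional_def by (intro add_mono k energy_contraction clamp_lipschitz)
qed

section \<open>Existence of the minimizer\<close>

lemma zero_dom:
  assumes "f \<in> Cc"
  shows "(\<lambda>x. 0) \<in> fdom f"
proof -
  have "kappa m \<phi> W f (\<lambda>x. 0) = (\<Sum>x | f x \<noteq> 0. ennreal (kappa_term f (\<lambda>x. 0) x))"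
    unfolding kappa_eq_nn_integral using assms
    by (intro nn_integral_count_space') (auto simp: Cc_def kappa_term_def Phi_0)
  also have "\<dots> < \<infinity>" using assms by (simp add: Cc_def)
  finally have "kappa m \<phi> W f (\<lambda>x. 0) < \<infinity>" .
  then show ?thesis
    by (auto simp: functional_domain_def Cc_def intro!: Cc_finite_energy0)
qed

lemma kappa_le_liminf:
  assumes "\<And>x. (\<lambda>n. U n x) \<longlonglongrightarrow> u x"
  shows "kappa m \<phi> W f u \<le> liminf (\<lambda>n. kappa m \<phi> W f (U n))"
proof -
  have "(\<lambda>n. kappa_term f (U n) x) \<longlonglongrightarrow> kappa_term f u x" for x
    unfolding kappa_term_def
    by (intro tendsto_intros isCont_tendsto_compose[OF isCont_Phi] assms)
  then have "liminf (\<lambda>n. ennreal (kappa_term f (U n) x)) = ennreal (kappa_term f u x)" for x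
    by (intro lim_imp_Liminf) (auto intro!: tendsto_ennrealI)
  then show ?thesis
    using nn_integral_liminf[of "\<lambda>n x. ennreal (kappa_term f (U n) x)" "count_space UNIV"]
    by (simp add: kappa_eq_nn_integral)
qed

text \<open>The midpoint of \<open>u\<close> and \<open>v\<close> is itself a competitor, of value
  at least \<open>I\<close>, so the parallelogram term is at most \<open>d\<close>. Undoing the
  halving of \<open>u - v\<close> costs the factor 4.\<close>

lemma minimizing_sequence_energy:
  assumes I: "\<And>v. v \<in> fdom f \<Longrightarrow> I \<le> fnl f v" "I < \<infinity>"
    and u: "u \<in> fdom f" "fnl f u \<le> I + d" and v: "v \<in> fdom f" "fnl f v \<le> I + d"
  shows "energy b (\<lambda>x. u x - v x) \<le> 4 * d"
proof -
  let ?w = "\<lambda>x. (u x + v x) / 2"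
  have "I + energy b (\<lambda>x. (u x - v x) / 2) \<le> fnl f ?w + energy b (\<lambda>x. (u x - v x) / 2) + ennreal 0"
    using I(1)[OF dom_midpoint[OF u(1) v(1)]] by (simp add: add_right_mono)
  also have "\<dots> \<le> (fnl f u + fnl f v) / 2"
    using kappa_term_midpoint[of f u v] by (intro fnl_midpoint_gap[of 0 f u v undefined]) auto
  also have "\<dots> \<le> ((I + d) + (I + d)) / 2"
    unfolding divide_ennreal_def by (intro mult_right_mono add_mono u v) auto
  also have "\<dots> = I + d" by (rule ennreal_half_double)
  finally have le: "energy b (\<lambda>x. (u x - v x) / 2) \<le> d"
    by (rule ennreal_add_le_imp_le) fact
  have "energy b (\<lambda>x. u x - v x) = ennreal 4 * energy b (\<lambda>x. (u x - v x) / 2)"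
    using energy_scale[of 2 "\<lambda>x. (u x - v x) / 2"] by (simp del: right_diff_distrib_numeral)
  also have "\<dots> \<le> 4 * d" using le by (simp add: mult_left_mono)
  finally show ?thesis .
qed

lemma ex_minimizer:
  assumes "0 < \<alpha>" "f \<in> Cc" "\<And>x. 0 \<le> f x" "\<And>x. f x \<le> \<alpha> * W x"
  shows "\<exists>u. is_minimizer f u"
proof -
  define I where "I = (INF v\<in>fdom f. fnl f v)"
  have I_le: "I \<le> fnl f v" if "v \<in> fdom f" for v
    unfolding I_def using that by (rule INF_lower)
  have I_fin: "I < \<infinity>"
    using I_le[OF zero_dom[OF assms(2)]] fnl_finite[OF zero_dom[OF assms(2)]] by (rule le_less_trans)
  have "\<exists>v\<in>fdom f. fnl f v < I + ennreal (1 / Suc n)" for n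
  proof -
    have "I < I + ennreal (1 / Suc n)"
      using I_fin by (cases I) (auto simp: ennreal_plus[symmetric] ennreal_less_iff simp del: ennreal_plus)
    then show ?thesis unfolding I_def by (subst (asm) INF_less_iff)
  qed
  then have "\<exists>V. \<forall>n. V n \<in> fdom f \<and> fnl f (V n) < I + ennreal (1 / Suc n)"
    by (intro choice allI) blast
  then obtain V where V: "\<And>n. V n \<in> fdom f" "\<And>n. fnl f (V n) < I + ennreal (1 / Suc n)"
    by blast
  define U where "U n x = clamp \<alpha> (V n x)" for n x
  have U: "U n \<in> fdom f" "fnl f (U n) \<le> I + ennreal (1 / Suc n)" for n
    using clamp_dom[OF assms(1,3,4) V(1)[of n]] V(2)[of n] unfolding U_def[abs_def] by auto
  \<comment> \<open>The truncated functions take values in [0, \<alpha>] on a countable set, so a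
    diagonal subsequence converges at every vertex.\<close>
  obtain k where k: "strict_mono k" "\<And>x. x \<in> UNIV \<Longrightarrow> \<exists>l. (\<lambda>n. U (k n) x) \<longlonglongrightarrow> l"
    using function_convergent_subsequence[of "UNIV :: 'a set" U \<alpha>] assms(1)
    by (auto simp: U_def clamp_def)
  define u where "u x = lim (\<lambda>n. U (k n) x)" for x
  have lim: "(\<lambda>n. U (k n) x) \<longlonglongrightarrow> u x" for x
    using k(2)[of x] unfolding u_def by (metis UNIV_I convergentI convergent_LIMSEQ_iff)
  \<comment> \<open>A strictly increasing \<open>k\<close> satisfies \<open>n \<le> k n\<close>, so
    the subsequence keeps the slack 1/(l+1) from index \<open>l\<close> on.\<close>
  have Uk: "fnl f (U (k n)) \<le> I + ennreal (1 / Suc l)" if "l \<le> n" for n l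
  proof -
    have "l \<le> k n" using that seq_suble[OF k(1), of n] by linarith
    then have "ennreal (1 / Suc (k n)) \<le> ennreal (1 / Suc l)"
      by (intro ennreal_leI frac_le) auto
    then show ?thesis using U(2)[of "k n"] by (meson add_left_mono order_trans)
  qed
  have inv: "(\<lambda>n. ennreal (1 / real (Suc n))) \<longlonglongrightarrow> ennreal 0"
    by (intro tendsto_ennrealI LIMSEQ_Suc[OF lim_1_over_n])
  \<comment> \<open>With \<open>n\<close> fixed, let \<open>l\<close> tend to infinity in the Cauchy
    estimate between \<open>U (k l)\<close> and \<open>U (k n)\<close>; Fatou's lemma carries the
    bound to the limit \<open>u\<close>.\<close>
  have dist: "energy b (\<lambda>x. u x - U (k n) x) \<le> 4 * ennreal (1 / Suc n)" for n
  proof -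
    have "energy b (\<lambda>x. u x - U (k n) x) \<le> liminf (\<lambda>l. energy b (\<lambda>x. U (k l) x - U (k n) x))"
      by (intro energy_le_liminf tendsto_intros lim)
    also have "\<dots> \<le> 4 * ennreal (1 / Suc n)"
    proof (rule liminf_le_ennreal)
      show "\<forall>\<^sub>F l in sequentially. energy b (\<lambda>x. U (k l) x - U (k n) x) \<le> 4 * ennreal (1 / Suc n)"
        using eventually_ge_at_top[of n]
        by eventually_elim (intro minimizing_sequence_energy[OF I_le I_fin] U Uk order_refl)
    qed
    finally show ?thesis .
  qed
  have conv: "(\<lambda>n. energy b (\<lambda>x. u x - U (k n) x)) \<longlonglongrightarrow> 0"
  proof (rule tendsto_sandwich[OF _ _ tendsto_const])
    show "(\<lambda>n. 4 * ennreal (1 / Suc n)) \<longlonglongrightarrow> 0"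
      using ennreal_tendsto_cmult[OF _ inv, of 4] by simp
  qed (use dist in \<open>auto intro!: always_eventually\<close>)
  have "u \<in> finite_energy0 b"
    by (rule finite_energy0_closed[OF _ lim conv]) (use U in \<open>auto simp: functional_domain_def\<close>)
  have "fnl f u \<le> liminf (\<lambda>n. energy b (U (k n))) + liminf (\<lambda>n. kappa m \<phi> W f (U (k n)))"
    unfolding functional_def by (intro add_mono energy_le_liminf kappa_le_liminf lim)
  also have "\<dots> \<le> liminf (\<lambda>n. fnl f (U (k n)))"
    unfolding functional_def by (rule liminf_add_le_ennreal)
  also have "\<dots> \<le> liminf (\<lambda>n. I + ennreal (1 / Suc n))"
    by (intro Liminf_mono always_eventually allI Uk order_refl)
  also have "\<dots> = I"
    using tendsto_add[OF tendsto_const inv, of I] by (intro lim_imp_Liminf) auto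
  finally have le: "fnl f u \<le> I" .
  then have "kappa m \<phi> W f u < \<infinity>"
    using I_fin by (auto simp: functional_def dest: le_less_trans)
  then have "u \<in> fdom f" using \<open>u \<in> finite_energy0 b\<close> by (simp add: functional_domain_def)
  then have "is_minimizer f u"
    using le I_le by (auto simp: is_minimizer_def intro: order_trans)
  then show ?thesis by blast
qed

text \<open>Existence and uniqueness together make the definite description in
  \<open>dirichlet_resolvent\<close> denote the minimizer.\<close>

lemma dirichlet_resolvent_minimizer:
  assumes "0 < \<alpha>" "f \<in> Cc" "\<And>x. 0 \<le> f x" "\<And>x. f x \<le> \<alpha> * W x"
  shows "is_minimizer f (dirichlet_resolvent b m \<phi> W f)"
proof -
  obtain u where u: "is_minimizer f u" using ex_minimizer[OF assms] by blast
  have "dirichlet_resolvent b m \<phi> W f = (THE u. is_minimizer f u)"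
    by (simp add: dirichlet_resolvent_def is_minimizer_def)
  moreover have "is_minimizer f (THE u. is_minimizer f u)"
    by (rule theI[of "is_minimizer f" u]) (use u is_minimizer_unique in blast)+
  ultimately show ?thesis by simp
qed

text \<open>Truncating the minimizer does not increase the functional, so the truncation is again a
  minimizer and by uniqueness equals the original.\<close>

lemma dirichlet_resolvent_bounds:
  assumes "0 < \<alpha>" "f \<in> Cc" "\<And>x. 0 \<le> f x" "\<And>x. f x \<le> \<alpha> * W x"
  shows "0 \<le> dirichlet_resolvent b m \<phi> W f x" "dirichlet_resolvent b m \<phi> W f x \<le> \<alpha>"
proof -
  let ?u = "dirichlet_resolvent b m \<phi> W f"
  have u: "is_minimizer f ?u" by (rule dirichlet_resolvent_minimizer[OF assms])
  then have "?u \<in> fdom f" by (simp add: is_minimizer_def)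
  from clamp_dom[OF assms(1,3,4) this] u have "is_minimizer f (\<lambda>x. clamp \<alpha> (?u x))"
    by (auto simp: is_minimizer_def intro: order_trans)
  from is_minimizer_unique[OF u this] have "?u x = clamp \<alpha> (?u x)" by metis
  then show "0 \<le> ?u x" "?u x \<le> \<alpha>" using assms(1) by (auto simp: clamp_def)
qed

end

section \<open>The Euler-Lagrange equation\<close>

text \<open>Rewritten as \<open>infsetsum\<close>, the integral lives on the row
  \<open>{x} \<times> UNIV\<close>, which the second coordinate reindexes. Together with the column
  version it evaluates the cross term of the energy at a vertex.\<close>

lemma integral_row:
  fixes g :: "'a \<Rightarrow> real"
  shows "(\<integral>p. (if fst p = x then g (snd p) else 0) \<partial>count_space UNIV) = (\<integral>y. g y \<partial>count_space UNIV)"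
proof -
  have "infsetsum (\<lambda>p. if fst p = x then g (snd p) else 0) UNIV = infsetsum (\<lambda>p. g (snd p)) ({x} \<times> UNIV)"
    by (rule infsetsum_cong_neutral) auto
  also have "\<dots> = infsetsum (\<lambda>y. g (snd (x, y))) UNIV"
    by (rule infsetsum_reindex_bij_betw[symmetric]) (auto simp: bij_betw_def inj_on_def)
  finally show ?thesis by (simp add: infsetsum_def)
qed

lemma integral_column:
  fixes g :: "'a \<Rightarrow> real"
  shows "(\<integral>p. (if snd p = x then g (fst p) else 0) \<partial>count_space UNIV) = (\<integral>y. g y \<partial>count_space UNIV)"
proof -
  have "infsetsum (\<lambda>p. if snd p = x then g (fst p) else 0) UNIV = infsetsum (\<lambda>p. g (fst p)) (UNIV \<times> {x})"
    by (rule infsetsum_cong_neutral) auto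
  also have "\<dots> = infsetsum (\<lambda>y. g (fst (y, x))) UNIV"
    by (rule infsetsum_reindex_bij_betw[symmetric]) (auto simp: bij_betw_def inj_on_def)
  finally show ?thesis by (simp add: infsetsum_def)
qed

context graph
begin

text \<open>The formal graph Laplacian without the factor 1/m. Being a Bochner integral, it takes
  the default value 0 where the row is not absolutely summable.\<close>

definition laplacian :: "('a \<Rightarrow> real) \<Rightarrow> 'a \<Rightarrow> real" where
  "laplacian u x = (\<integral>y. b x y * (u x - u y) \<partial>count_space UNIV)"

lemma integrable_b: "integrable (count_space UNIV) (b x)"
  using abs_summable_equivalent[of "b x" UNIV] b_summable[of x]
  by (simp add: abs_summable_on_def)

lemma vertex_degree_eq_integral: "vertex_degree b x = (\<integral>y. b x y \<partial>count_space UNIV)"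
  using infsetsum_infsum[of "b x" UNIV] integrable_b[of x]
  by (simp add: vertex_degree_def infsetsum_def abs_summable_on_def)

lemma vertex_degree_nonneg: "0 \<le> vertex_degree b x"
  by (simp add: vertex_degree_eq_integral)

lemma vertex_degree_zero_iff: "vertex_degree b x = 0 \<longleftrightarrow> (\<forall>y. b x y = 0)"
  unfolding vertex_degree_eq_integral
  by (subst integral_nonneg_eq_0_iff_AE) (auto simp: integrable_b AE_count_space)

lemma integrable_edge_energy: "u \<in> finite_energy b \<Longrightarrow> integrable (count_space UNIV) (edge_energy u)"
  by (intro integrableI_nonneg) (auto simp: finite_energy_def energy_eq_nn_integral)

lemma energy_eq_integral:
  "u \<in> finite_energy b \<Longrightarrow> energy b u = ennreal (\<integral>p. edge_energy u p \<partial>count_space UNIV)"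
  unfolding energy_eq_nn_integral
  by (intro nn_integral_eq_integral integrable_edge_energy) auto

text \<open>Expanding the square on each edge gives a quadratic polynomial in \<open>t\<close>. In
  its linear term only pairs touching \<open>x\<close> remain, once as a row and once as a column,
  and each of the two adds \<open>laplacian u x\<close>.\<close>

lemma integral_edge_energy_add_delta:
  assumes "u \<in> finite_energy b"
  shows "(\<integral>p. edge_energy (\<lambda>y. u y + t * indicat_real {x} y) p \<partial>count_space UNIV) =
    (\<integral>p. edge_energy u p \<partial>count_space UNIV) + t * (2 * laplacian u x)
      + t\<^sup>2 * (\<integral>p. edge_energy (indicat_real {x}) p \<partial>count_space UNIV)"
proof -
  let ?\<delta> = "indicat_real {x}"
  define c where "c p = b (fst p) (snd p) * (u (fst p) - u (snd p)) * (?\<delta> (fst p) - ?\<delta> (snd p))" for p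
  note int_u = integrable_edge_energy[OF assms] and int_d = integrable_edge_energy[OF finite_energy_delta[of x]]
  have int_c: "integrable (count_space UNIV) c"
  \<comment> \<open>The cross term is dominated by the sum of the two edge energies, by the
    inequality 2st \<le> s*s + t*t.\<close>
  proof (rule Bochner_Integration.integrable_bound[OF Bochner_Integration.integrable_add[OF int_u int_d]])
    show "AE p in count_space UNIV. norm (c p) \<le> norm (edge_energy u p + edge_energy ?\<delta> p)"
    proof (intro AE_I2)
      fix p
      let ?s = "u (fst p) - u (snd p)" and ?d = "?\<delta> (fst p) - ?\<delta> (snd p)"
      have "\<bar>?s * ?d\<bar> \<le> (?s\<^sup>2 + ?d\<^sup>2) / 2"
        using sum_squares_bound[of "\<bar>?s\<bar>" "\<bar>?d\<bar>"] by (simp add: abs_mult)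
      then have "b (fst p) (snd p) * \<bar>?s * ?d\<bar> \<le> b (fst p) (snd p) * ((?s\<^sup>2 + ?d\<^sup>2) / 2)"
        by (intro mult_left_mono) auto
      then have "\<bar>c p\<bar> \<le> edge_energy u p + edge_energy ?\<delta> p"
        by (simp add: c_def edge_energy_def abs_mult mult.assoc distrib_left add_divide_distrib)
      then show "norm (c p) \<le> norm (edge_energy u p + edge_energy ?\<delta> p)" by simp
    qed
  qed simp
  \<comment> \<open>The pair (x, x) belongs to both the row and the column, but contributes 0 to
    each.\<close>
  have split: "c p = (if fst p = x then b x (snd p) * (u x - u (snd p)) else 0)
      + (if snd p = x then b x (fst p) * (u x - u (fst p)) else 0)" for p
    by (cases p) (auto simp: c_def b_sym[of _ x] algebra_simps)
  have int_c1: "integrable (count_space UNIV) (\<lambda>p. if fst p = x then b x (snd p) * (u x - u (snd p)) else 0)"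
    by (rule Bochner_Integration.integrable_bound[OF int_c]) (auto simp: c_def indicator_def)
  have int_c2: "integrable (count_space UNIV) (\<lambda>p. if snd p = x then b x (fst p) * (u x - u (fst p)) else 0)"
    by (rule Bochner_Integration.integrable_bound[OF int_c])
       (auto simp: c_def indicator_def b_sym[of _ x] abs_mult abs_minus_commute)
  have "(\<integral>p. c p \<partial>count_space UNIV) = laplacian u x + laplacian u x"
    unfolding split Bochner_Integration.integral_add[OF int_c1 int_c2] laplacian_def
    by (simp only: integral_row[of x "\<lambda>y. b x y * (u x - u y)"] integral_column[of x "\<lambda>y. b x y * (u x - u y)"])
  moreover have "edge_energy (\<lambda>y. u y + t * ?\<delta> y) p = edge_energy u p + t * c p + t\<^sup>2 * edge_energy ?\<delta> p" for p
    by (simp add: edge_energy_def c_def power2_eq_square algebra_simps add_divide_distrib diff_divide_distrib)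
  ultimately show ?thesis
    using int_u int_d int_c by simp
qed

end

context nonlinear_graph
begin

text \<open>Varying \<open>u\<close> at the vertex \<open>x\<close> alone turns the functional into
  a differentiable real function of \<open>t\<close> with a global minimum at 0; its derivative
  there vanishes.\<close>

lemma euler_lagrange:
  assumes u: "is_minimizer f u"
  shows "laplacian u x = m x * \<phi> (f x - W x * u x)"
proof -
  let ?\<delta> = "indicat_real {x}"
  define v where "v t y = u y + t * ?\<delta> y" for t y
  have dom_u: "u \<in> finite_energy0 b" "u \<in> finite_energy b" "kappa m \<phi> W f u < \<infinity>"
    using u by (auto simp: is_minimizer_def functional_domain_def finite_energy0_def)
  have delta: "(\<lambda>y. t * ?\<delta> y) \<in> Cc" for t
    unfolding Cc_def mem_Collect_eq by (rule finite_subset[of _ "{x}"]) (auto simp: indicator_def)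
  have v0: "v t \<in> finite_energy0 b" "v t \<in> finite_energy b" for t
    using finite_energy0_add[OF dom_u(1) Cc_finite_energy0[OF delta[of t]]]
    unfolding v_def[abs_def] by (auto simp: finite_energy0_def)
  \<comment> \<open>The variation changes only the term of \<open>kappa\<close> at \<open>x\<close>,
    and \<open>d t\<close> is that change.\<close>
  define d where "d t = kappa_term f (v t) x - kappa_term f u x" for t
  have term_v: "kappa_term f (v t) y = kappa_term f u y + d t * ?\<delta> y" for t y
    by (auto simp: d_def v_def kappa_term_def split: split_indicator)
  have int_k: "integrable (count_space UNIV) (kappa_term f u)"
    using dom_u(3) by (intro integrableI_nonneg) (auto simp: kappa_eq_nn_integral kappa_term_nonneg)
  have int_d: "integrable (count_space UNIV) ?\<delta>"
    by (rule integrable_real_indicator) auto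
  have int_kv: "integrable (count_space UNIV) (kappa_term f (v t))" for t
    unfolding term_v[abs_def] using int_k int_d by simp
  have kappa_v: "kappa m \<phi> W f (v t) = ennreal (\<integral>y. kappa_term f (v t) y \<partial>count_space UNIV)" for t
    unfolding kappa_eq_nn_integral by (intro nn_integral_eq_integral int_kv) (simp add: kappa_term_nonneg)
  define E K A where "E = (\<integral>p. edge_energy u p \<partial>count_space UNIV)"
    and "K = (\<integral>y. kappa_term f u y \<partial>count_space UNIV)"
    and "A = (\<integral>p. edge_energy ?\<delta> p \<partial>count_space UNIV)"
  have int_v: "(\<integral>y. kappa_term f (v t) y \<partial>count_space UNIV) = K + d t" for t
    unfolding term_v K_def using int_k int_d by (simp add: measure_count_space)
  have en_v: "(\<integral>p. edge_energy (v t) p \<partial>count_space UNIV) = E + t * (2 * laplacian u x) + t\<^sup>2 * A" for t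
    unfolding v_def[abs_def] E_def A_def by (rule integral_edge_energy_add_delta[OF dom_u(2)])
  have fnl_v: "fnl f (v t) = ennreal (E + t * (2 * laplacian u x) + t\<^sup>2 * A + (K + d t))" for t
  proof -
    have "0 \<le> (\<integral>y. kappa_term f (v t) y \<partial>count_space UNIV)" "0 \<le> (\<integral>p. edge_energy (v t) p \<partial>count_space UNIV)"
      by (auto intro!: integral_nonneg_AE simp: kappa_term_nonneg)
    then show ?thesis
      unfolding functional_def energy_eq_integral[OF v0(2)] kappa_v int_v en_v by simp
  qed
  have "v 0 = u" by (auto simp: v_def fun_eq_iff)
  then have "d 0 = 0" by (simp add: d_def)
  have fnl_u: "fnl f u = ennreal (E + K)" using fnl_v[of 0] \<open>v 0 = u\<close> \<open>d 0 = 0\<close> by simp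
  have EK: "0 \<le> E" "0 \<le> K"
    unfolding E_def K_def by (auto intro!: integral_nonneg_AE simp: kappa_term_nonneg)
  have min: "0 \<le> t * (2 * laplacian u x) + t\<^sup>2 * A + d t" for t
  proof -
    have "v t \<in> fdom f" using v0 kappa_v by (simp add: functional_domain_def)
    then have "fnl f u \<le> fnl f (v t)" using u by (simp add: is_minimizer_def)
    moreover have "0 \<le> E + t * (2 * laplacian u x) + t\<^sup>2 * A"  "0 \<le> K + d t"
      unfolding en_v[symmetric] int_v[symmetric] by (auto intro!: integral_nonneg_AE simp: kappa_term_nonneg)
    ultimately have "E + K \<le> E + t * (2 * laplacian u x) + t\<^sup>2 * A + (K + d t)"
      unfolding fnl_v fnl_u by (subst (asm) ennreal_le_iff) auto
    then show ?thesis by simp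
  qed
  \<comment> \<open>\<open>h\<close> is the increment of the functional along the variation, with
    \<Phi> made explicit for differentiation.\<close>
  define h where "h t = t * (2 * laplacian u x) + t\<^sup>2 * A +
    (\<Phi> (f x - W x * (u x + t)) * (m x / W x) - kappa_term f u x)" for t
  have h: "h t = t * (2 * laplacian u x) + t\<^sup>2 * A + d t" for t
    by (simp add: h_def d_def v_def kappa_term_def)
  have "(h has_real_derivative
      2 * laplacian u x + 2 * 0 * A + (2 * \<phi> (f x - W x * (u x + 0))) * (- W x) * (m x / W x)) (at 0)"
    unfolding h_def[abs_def]
    by (auto intro!: derivative_eq_intros DERIV_chain2[OF Phi_deriv])
  \<comment> \<open>The minimum is global, so the radius 1 is an arbitrary choice. The weight
    \<open>W x\<close> from the chain rule cancels the one in \<open>m x / W x\<close>.\<close>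
  then have "2 * laplacian u x + 2 * 0 * A + (2 * \<phi> (f x - W x * (u x + 0))) * (- W x) * (m x / W x) = 0"
    by (rule DERIV_local_min[where d = 1]) (use min \<open>d 0 = 0\<close> in \<open>auto simp: h\<close>)
  then show ?thesis using W_pos[of x] by (simp add: field_simps)
qed

section \<open>Stochastic completeness\<close>

text \<open>Averaging argument: the equation says that the increments \<open>w y - w x\<close>,
  averaged with weights \<open>b x y / deg x\<close>, equal \<open>?c\<close>, so not all neighbours
  can stay strictly below \<open>?c\<close>.\<close>

lemma ex_increasing_neighbour:
  assumes bnd: "\<And>y. \<bar>w y\<bar> \<le> \<alpha>"
    and eq: "laplacian w x = - (m x * \<phi> (W x * w x))"
    and pos: "0 < w x"
  shows "\<exists>y. adjacent b x y \<and> w x + m x * \<phi> (W x * w x) / vertex_degree b x \<le> w y"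
proof (rule ccontr)
  assume contr: "\<not> ?thesis"
  let ?c = "m x * \<phi> (W x * w x) / vertex_degree b x"
  have rhs: "0 < m x * \<phi> (W x * w x)"
    using pos by (intro mult_pos_pos m_pos phi_pos W_pos)
  \<comment> \<open>At an isolated vertex the Laplacian is 0, which contradicts the nonzero
    right-hand side.\<close>
  have deg: "vertex_degree b x \<noteq> 0"
  proof
    assume "vertex_degree b x = 0"
    then have "laplacian w x = 0" by (simp add: vertex_degree_zero_iff laplacian_def)
    with eq rhs show False by linarith
  qed
  have int: "integrable (count_space UNIV) (\<lambda>y. b x y * (w x - w y))"
  proof (rule Bochner_Integration.integrable_bound)
    show "integrable (count_space UNIV) (\<lambda>y. b x y * (2 * \<alpha>))"
      using integrable_b[of x] by simp
    show "AE y in count_space UNIV. norm (b x y * (w x - w y)) \<le> norm (b x y * (2 * \<alpha>))"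
    proof (intro AE_I2)
      fix y
      have "\<bar>w x - w y\<bar> \<le> \<bar>2 * \<alpha>\<bar>" using bnd[of x] bnd[of y] by linarith
      then show "norm (b x y * (w x - w y)) \<le> norm (b x y * (2 * \<alpha>))"
        by (simp add: abs_mult mult_left_mono)
    qed
  qed simp
  have less: "w y - w x < ?c" if "b x y > 0" for y
    using contr that by (auto simp: adjacent_def not_le)
  \<comment> \<open>These terms are nonnegative and sum to
    \<open>vertex_degree b x * ?c + laplacian w x = 0\<close>, so each vanishes; at an actual
    neighbour this is impossible.\<close>
  have nonneg: "0 \<le> b x y * ?c + b x y * (w x - w y)" for y
  proof (cases "b x y = 0")
    case False
    then have "w y - w x < ?c" using less[of y] b_nonneg[of x y] by linarith
    then have "0 \<le> b x y * (?c + (w x - w y))" by (intro mult_nonneg_nonneg) auto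
    then show ?thesis by (simp only: distrib_left)
  qed simp
  have int2: "integrable (count_space UNIV) (\<lambda>y. b x y * ?c + b x y * (w x - w y))"
    using int integrable_b[of x] by simp
  have "(\<integral>y. b x y * ?c + b x y * (w x - w y) \<partial>count_space UNIV) = vertex_degree b x * ?c + laplacian w x"
    using int integrable_b[of x] by (simp add: vertex_degree_eq_integral laplacian_def)
  also have "\<dots> = 0" using deg eq by simp
  finally have "(\<integral>y. b x y * ?c + b x y * (w x - w y) \<partial>count_space UNIV) = 0" .
  then have "AE y in count_space UNIV. b x y * ?c + b x y * (w x - w y) = 0"
    by (rule iffD1[OF integral_nonneg_eq_0_iff_AE[OF int2 AE_I2[OF nonneg]]])
  then have zero: "b x y * (?c - (w y - w x)) = 0" for y
    by (simp add: AE_count_space algebra_simps)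
  obtain y where y: "b x y \<noteq> 0" using deg vertex_degree_zero_iff by blast
  then have "b x y > 0" by (metis b_nonneg less_le)
  with zero[of y] less[of y] show False by simp
qed

lemma bounded_solution_nonpos:
  assumes bnd: "\<And>y. \<bar>w y\<bar> \<le> \<alpha>"
    and eq: "\<And>x. laplacian w x = - (m x * \<phi> (W x * w x))"
    and div: "\<And>a p. 0 < a \<Longrightarrow> a \<le> 1 \<Longrightarrow> infinite_path b p \<Longrightarrow>
      (\<Sum>n. ennreal (m (p n) * \<phi> (a * W (p n)) / vertex_degree b (p n))) = \<infinity>"
  shows "w x0 \<le> 0"
proof (rule ccontr)
  assume "\<not> w x0 \<le> 0"
  then have pos: "0 < w x0" by simp
  let ?inc = "\<lambda>x. m x * \<phi> (W x * w x) / vertex_degree b x"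
  \<comment> \<open>The invariant \<open>w x0 \<le> w (p n)\<close> keeps \<open>w\<close> positive
    along the path, so the neighbour lemma applies at every step.\<close>
  have "\<exists>p. \<forall>n. w x0 \<le> w (p n) \<and> (adjacent b (p n) (p (Suc n)) \<and> w (p n) + ?inc (p n) \<le> w (p (Suc n)))"
  proof (rule dependent_nat_choice)
    show "\<exists>x. w x0 \<le> w x" by blast
    fix x and n :: nat assume x: "w x0 \<le> w x"
    with pos have "0 < w x" by simp
    from ex_increasing_neighbour[OF bnd eq this]
    obtain y where y: "adjacent b x y" "w x + ?inc x \<le> w y" by blast
    have "0 \<le> ?inc x"
      using \<open>0 < w x\<close> m_pos[of x] W_pos[of x] vertex_degree_nonneg[of x]
      by (intro divide_nonneg_nonneg mult_nonneg_nonneg phi_nonneg) auto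
    then have "w x0 \<le> w y" using x y(2) by linarith
    with y show "\<exists>y. w x0 \<le> w y \<and> (adjacent b x y \<and> w x + ?inc x \<le> w y)" by blast
  qed
  then obtain p where p: "\<And>n. w x0 \<le> w (p n)" "\<And>n. adjacent b (p n) (p (Suc n))"
    "\<And>n. w (p n) + ?inc (p n) \<le> w (p (Suc n))" by blast
  \<comment> \<open>The divergence hypothesis is available for \<open>a \<le> 1\<close> only, and
    \<open>a \<le> w x0 \<le> w (p n)\<close> lets monotonicity of \<phi> compare its terms with the
    increments of \<open>w\<close>.\<close>
  define a where "a = min 1 (w x0)"
  have a: "0 < a" "a \<le> 1" "a \<le> w x0" using pos by (auto simp: a_def)
  let ?s = "\<lambda>n. m (p n) * \<phi> (a * W (p n)) / vertex_degree b (p n)"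
  have s_nonneg: "0 \<le> ?s n" for n
    using a(1) m_pos[of "p n"] W_pos[of "p n"] vertex_degree_nonneg[of "p n"]
    by (intro divide_nonneg_nonneg mult_nonneg_nonneg phi_nonneg) auto
  have step: "?s n \<le> w (p (Suc n)) - w (p n)" for n
  proof -
    have "a * W (p n) \<le> W (p n) * w (p n)"
      using a(3) p(1)[of n] W_pos[of "p n"] by (simp add: mult.commute)
    then have "\<phi> (a * W (p n)) \<le> \<phi> (W (p n) * w (p n))"
      using strict_mono_less_eq[OF phi_mono] by blast
    then have "?s n \<le> ?inc (p n)"
      using m_pos[of "p n"] vertex_degree_nonneg[of "p n"]
      by (intro divide_right_mono mult_left_mono) auto
    then show ?thesis using p(3)[of n] by linarith
  qed
  \<comment> \<open>The increments telescope, and \<open>\<bar>w\<bar> \<le> \<alpha>\<close> at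
    both ends bounds every partial sum by 2\<alpha>.\<close>
  have "(\<Sum>n<N. ?s n) \<le> w (p N) - w (p 0)" for N
    using sum_mono[of "{..<N}" ?s, OF step] by (simp add: sum_lessThan_telescope[of "\<lambda>n. w (p n)"])
  then have "(\<Sum>n<N. ?s n) \<le> 2 * \<alpha>" for N
    using bnd[of "p N"] bnd[of "p 0"] by (smt (verit))
  then have "(\<Sum>n<N. ennreal (?s n)) \<le> ennreal (2 * \<alpha>)" for N
    by (simp add: sum_ennreal s_nonneg ennreal_leI)
  then have "(\<Sum>n. ennreal (?s n)) \<le> ennreal (2 * \<alpha>)"
    by (simp add: suminf_eq_SUP SUP_least)
  moreover have "(\<Sum>n. ennreal (?s n)) = \<infinity>"
    using p(2) by (intro div a) (simp add: infinite_path_def)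
  ultimately show False by (simp add: top_unique)
qed

lemma stochastically_complete_if_divergent:
  assumes div: "\<And>a p. 0 < a \<Longrightarrow> a \<le> 1 \<Longrightarrow> infinite_path b p \<Longrightarrow>
      (\<Sum>n. ennreal (m (p n) * \<phi> (a * W (p n)) / vertex_degree b (p n))) = \<infinity>"
  shows "stochastically_complete_at_infinity b m \<phi> W"
  unfolding stochastically_complete_at_infinity_def
proof (intro allI impI ext)
  fix \<alpha> :: real and z :: 'a assume \<alpha>: "0 < \<alpha>"
  \<comment> \<open>\<open>g n\<close> equals \<open>\<alpha> * W\<close> on the first
    \<open>n\<close> vertices and 0 elsewhere, so it is admissible in the supremum defining the
    extended resolvent.\<close>
  define g where "g n x = (if to_nat x < n then \<alpha> * W x else 0)" for n and x :: 'a
  have "finite {x. g n x \<noteq> 0}" for n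
    by (rule finite_subset[OF _ finite_to_nat_less[of n]]) (auto simp: g_def split: if_splits)
  then have g: "g n \<in> Cc" "0 \<le> g n x" "g n x \<le> \<alpha> * W x" for n x
    using \<alpha> W_pos[of x] by (auto simp: g_def Cc_def)
  let ?R = "dirichlet_resolvent b m \<phi> W"
  have R: "0 \<le> ?R (g n) x" "?R (g n) x \<le> \<alpha>" for n x
    using dirichlet_resolvent_bounds[OF \<alpha> g] by auto
  obtain k where k: "strict_mono k" "\<And>x. x \<in> UNIV \<Longrightarrow> \<exists>l. (\<lambda>n. ?R (g (k n)) x) \<longlonglongrightarrow> l"
    using function_convergent_subsequence[of "UNIV :: 'a set" "\<lambda>n. ?R (g n)" \<alpha>] R by auto
  define u where "u x = lim (\<lambda>n. ?R (g (k n)) x)" for x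
  have lim: "(\<lambda>n. ?R (g (k n)) x) \<longlonglongrightarrow> u x" for x
    using k(2)[of x] unfolding u_def by (metis UNIV_I convergentI convergent_LIMSEQ_iff)
  have u: "0 \<le> u x" "u x \<le> \<alpha>" for x
    using LIMSEQ_le_const[OF lim] LIMSEQ_le_const2[OF lim] R by blast+
  \<comment> \<open>The Euler-Lagrange equations pass to the limit: the rows are dominated by
    \<open>b x y * \<alpha>\<close>, and at a fixed vertex \<open>g (k n) x\<close> is eventually
    \<open>\<alpha> * W x\<close>.\<close>
  have lap_u: "laplacian u x = m x * \<phi> (\<alpha> * W x - W x * u x)" for x
  proof (rule LIMSEQ_unique)
    show "(\<lambda>n. laplacian (?R (g (k n))) x) \<longlonglongrightarrow> laplacian u x"
      unfolding laplacian_def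
    proof (rule integral_dominated_convergence)
      show "integrable (count_space UNIV) (\<lambda>y. b x y * \<alpha>)" using integrable_b[of x] by simp
      show "AE y in count_space UNIV. (\<lambda>n. b x y * (?R (g (k n)) x - ?R (g (k n)) y)) \<longlonglongrightarrow> b x y * (u x - u y)"
        by (intro AE_I2 tendsto_intros lim)
      show "AE y in count_space UNIV. norm (b x y * (?R (g (k n)) x - ?R (g (k n)) y)) \<le> b x y * \<alpha>" for n
      proof (intro AE_I2)
        fix y
        have "\<bar>?R (g (k n)) x - ?R (g (k n)) y\<bar> \<le> \<alpha>"
          using R[of "k n" x] R[of "k n" y] by linarith
        then show "norm (b x y * (?R (g (k n)) x - ?R (g (k n)) y)) \<le> b x y * \<alpha>"
          by (simp add: abs_mult mult_left_mono)
      qed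
    qed auto
    have "\<forall>\<^sub>F n in sequentially. g (k n) x = \<alpha> * W x"
      using eventually_gt_at_top[of "to_nat x"]
    proof eventually_elim
      case (elim n)
      then show ?case using seq_suble[OF k(1), of n] by (simp add: g_def)
    qed
    then have "(\<lambda>n. g (k n) x) \<longlonglongrightarrow> \<alpha> * W x" by (rule tendsto_eventually)
    then have "(\<lambda>n. m x * \<phi> (g (k n) x - W x * ?R (g (k n)) x)) \<longlonglongrightarrow> m x * \<phi> (\<alpha> * W x - W x * u x)"
      by (intro tendsto_intros continuous_on_tendsto_compose[OF phi_cont] lim) auto
    moreover have "laplacian (?R (g n)) x = m x * \<phi> (g n x - W x * ?R (g n) x)" for n
      by (rule euler_lagrange[OF dirichlet_resolvent_minimizer[OF \<alpha> g]])
    ultimately show "(\<lambda>n. laplacian (?R (g (k n))) x) \<longlonglongrightarrow> m x * \<phi> (\<alpha> * W x - W x * u x)" by simp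
  qed
  have "laplacian (\<lambda>y. \<alpha> - u y) x = - laplacian u x" for x
    unfolding laplacian_def
    by (subst integral_minus[symmetric]) (simp add: algebra_simps)
  then have "\<alpha> - u z \<le> 0"
    using u by (intro bounded_solution_nonpos[of "\<lambda>y. \<alpha> - u y" \<alpha>, OF _ _ div])
      (auto simp: lap_u algebra_simps abs_le_iff)
  then have uz: "u z = \<alpha>" using u(2)[of z] by simp
  show "extended_resolvent b m \<phi> W (\<lambda>x. \<alpha> * W x) z = ereal \<alpha>"
    unfolding extended_resolvent_def
  proof (rule antisym)
    show "(SUP g\<in>{g \<in> Cc. \<forall>y. 0 \<le> g y \<and> g y \<le> \<alpha> * W y}. ereal (?R g z)) \<le> ereal \<alpha>"
      by (intro SUP_least) (auto intro!: dirichlet_resolvent_bounds[OF \<alpha>])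
    \<comment> \<open>The supremum dominates every \<open>?R (g (k n)) z\<close>, hence also their
      limit \<open>u z = \<alpha>\<close>.\<close>
    have "(\<lambda>n. ereal (?R (g (k n)) z)) \<longlonglongrightarrow> ereal \<alpha>" using lim[of z] uz by simp
    then show "ereal \<alpha> \<le> (SUP g\<in>{g \<in> Cc. \<forall>y. 0 \<le> g y \<and> g y \<le> \<alpha> * W y}. ereal (?R g z))"
      by (rule LIMSEQ_le_const2) (use g in \<open>auto intro!: SUP_upper\<close>)
  qed
qed

text \<open>With \<open>C\<close> a bound for deg/m, every term of the series is at least the
  positive constant \<phi>(a inf W)/C.\<close>

lemma path_sum_divergent:
  assumes inf: "0 < (INF x. W x)"
    and bnd: "bounded (range (\<lambda>x. vertex_degree b x / m x))"
    and a: "0 < a" and p: "infinite_path b p"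
  shows "(\<Sum>n. ennreal (m (p n) * \<phi> (a * W (p n)) / vertex_degree b (p n))) = \<infinity>"
proof -
  obtain C where C: "0 < C" "\<And>x. \<bar>vertex_degree b x / m x\<bar> \<le> C"
    using bnd unfolding bounded_pos by auto
  let ?w = "INF x. W x"
  have w: "?w \<le> W x" for x
    by (rule cINF_lower) (auto intro!: bdd_belowI[of _ 0] less_imp_le[OF W_pos])
  let ?e = "\<phi> (a * ?w) / C"
  have "0 < ?e" using a inf C by (intro divide_pos_pos phi_pos) auto
  have le: "?e \<le> m (p n) * \<phi> (a * W (p n)) / vertex_degree b (p n)" for n
  proof -
    \<comment> \<open>A vertex on an infinite path has a neighbour, so its degree is positive and
      the quotient is a genuine one, not the default value of division by 0.\<close>
    have "b (p n) (p (Suc n)) > 0" using p by (simp add: infinite_path_def adjacent_def)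
    then have deg: "0 < vertex_degree b (p n)"
      using vertex_degree_zero_iff[of "p n"] vertex_degree_nonneg[of "p n"] by (force simp: less_le)
    have "vertex_degree b (p n) \<le> C * m (p n)"
      using C(2)[of "p n"] m_pos[of "p n"] by (simp add: field_simps abs_le_iff)
    then have "1 / C \<le> m (p n) / vertex_degree b (p n)"
      using deg C(1) by (simp add: field_simps)
    moreover have "\<phi> (a * ?w) \<le> \<phi> (a * W (p n))"
      using strict_mono_less_eq[OF phi_mono] w[of "p n"] a by simp
    moreover have "0 \<le> \<phi> (a * ?w)" using a inf by (intro phi_nonneg) auto
    ultimately have "(1 / C) * \<phi> (a * ?w) \<le> m (p n) / vertex_degree b (p n) * \<phi> (a * W (p n))"
      using C(1) deg m_pos[of "p n"] by (intro mult_mono) auto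
    then show ?thesis by simp
  qed
  have "(\<Sum>n::nat. e) = \<infinity>" if "e \<noteq> 0" for e :: ennreal
    using that by (simp add: nn_integral_count_space_nat[symmetric] ennreal_mult_top)
  moreover have "ennreal ?e \<noteq> 0"
    using \<open>0 < ?e\<close> by (simp only: ennreal_eq_0_iff not_le)
  ultimately have "(\<Sum>n::nat. ennreal ?e) = \<infinity>" by blast
  moreover have "(\<Sum>n::nat. ennreal ?e) \<le> (\<Sum>n. ennreal (m (p n) * \<phi> (a * W (p n)) / vertex_degree b (p n)))"
    by (intro suminf_le ennreal_leI le) auto
  ultimately show ?thesis by (simp add: top_unique)
qed

end

theorem proposition4p5:
  fixes b :: "'a::countable \<Rightarrow> 'a \<Rightarrow> real"
    and m W :: "'a \<Rightarrow> real"
    and \<phi> :: "real \<Rightarrow> real"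
  assumes graph: "weighted_graph b"
    and m_pos: "\<And>x. 0 < m x"
    and phi_cont: "continuous_on UNIV \<phi>"
    and phi_mono: "strict_mono \<phi>"
    and phi_0: "\<phi> 0 = 0"
    and W_pos: "\<And>x. 0 < W x"
    and W_inf: "0 < (INF x. W x)"
  shows "((\<forall>\<alpha> p. 0 < \<alpha> \<and> \<alpha> \<le> 1 \<and> infinite_path b p \<longrightarrow>
             (\<Sum>n. ennreal (m (p n) * \<phi> (\<alpha> * W (p n)) / vertex_degree b (p n))) = \<infinity>)
          \<longrightarrow> stochastically_complete_at_infinity b m \<phi> W)
       \<and> (bounded (range (\<lambda>x. vertex_degree b x / m x))
          \<longrightarrow> stochastically_complete_at_infinity b m \<phi> W)"
proof -
  interpret nonlinear_graph b m W \<phi>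
    by unfold_locales (use assms in auto)
  show ?thesis
    using stochastically_complete_if_divergent path_sum_divergent[OF W_inf] by blast
qed

end
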